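(* Let $N\in\mathbb{N}$. There is $C>1$ such that $$C^{-1}\|v\|\le\|v\|_{\mathbb{D}(\mathbb{R}^N)}\le C\|v\|\qquad\text{for all }v\in C_c^\infty(\mathbb{R}^N).$$ As a consequence, there is an isomorphism between $\mathbb{D}(\mathbb{R}^N)$ and $D^{log}(\mathbb{R}^N)$.
   Context: $\mathbb{S}^N\subset\mathbb{R}^{N+1}$ is the unit sphere with round metric $g$ and volume element $dV_g$; $|z-\zeta|$ is the Euclidean distance in $\mathbb{R}^{N+1}$; $\psi=\Gamma'/\Gamma$, $c_N=\pi^{-N/2}\Gamma(\tfrac N2)$, $A_N=2\psi(\tfrac N2)$, and $\kappa>\max\{2(\psi(\tfrac N2)-\psi(\tfrac N4)),A_N,1\}$ is a fixed constant. $\mathbb{H}(\mathbb{S}^N)$ is the completion of $C^\infty(\mathbb{S}^N)$ with respect to the norm $$\|u\|_{\mathbb{H}(\mathbb{S}^N)}=\left(\frac{c_N}{2}\int_{\mathbb{S}^N}\int_{\mathbb{S}^N}\frac{(u(z)-u(\zeta))^2}{|z-\zeta|^N}\,dV_g(z)\,dV_g(\zeta)+\kappa\int_{\mathbb{S}^N}u^2\,dV_g\right)^{1/2};$$ equivalently $\mathbb{H}(\mathbb{S}^N)=\{u\in L^2(\mathbb{S}^N):\|u\|_{\mathbb{H}(\mathbb{S}^N)}<\infty\}$. With $\sigma^{-1}(x)=\left(\frac{2x}{1+|x|^2},\frac{1-|x|^2}{1+|x|^2}\right)$ (inverse stereographic projection), $\phi(x)=\frac2{1+|x|^2}$, let $\iota(u)(x)=\phi(x)^{N/2}u(\sigma^{-1}(x))$.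 Then $\mathbb{D}(\mathbb{R}^N):=\iota(\mathbb{H}(\mathbb{S}^N))$ with norm $\|v\|_{\mathbb{D}(\mathbb{R}^N)}:=\|u\|_{\mathbb{H}(\mathbb{S}^N)}$ if $v=\iota(u)$. Finally, $\|v\|^2=\frac{c_N}{2}\int_{\mathbb{R}^N}\int_{B_1(x)}\frac{(v(x)-v(y))^2}{|x-y|^N}\,dy\,dx+\int_{\mathbb{R}^N}v(x)^2\ln(e+|x|^2)\,dx$ and $D^{log}(\mathbb{R}^N)=\{v\in L^2(\mathbb{R}^N):\|v\|<\infty\}$ with norm $\|\cdot\|$. "Isomorphism" means linear bijection that is bounded with bounded inverse. *)

theory Defs
  imports "HOL-Analysis.Analysis"
begin

text \<open>
  The Euclidean space of dimension \<open>N = CARD('n)\<close> is \<open>real ^ 'n\<close>, and the one of dimension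
  \<open>N + 1\<close> is \<open>(real ^ 'n) \<times> real\<close>, whose norm is again the Euclidean one.
\<close>

definition c_const :: "nat \<Rightarrow> real" where
  "c_const N = pi powr (- real N / 2) * Gamma (real N / 2)"

definition A_const :: "nat \<Rightarrow> real" where
  "A_const N = 2 * Digamma (real N / 2)"


subsection \<open>The sphere and its Riemannian volume\<close>

definition stereo_inv :: "real ^ 'n \<Rightarrow> (real ^ 'n) \<times> real" where
  "stereo_inv x = ((2 / (1 + (norm x)\<^sup>2)) *\<^sub>R x, (1 - (norm x)\<^sup>2) / (1 + (norm x)\<^sup>2))"

definition conf_factor :: "real ^ 'n \<Rightarrow> real" where
  "conf_factor x = 2 / (1 + (norm x)\<^sup>2)"

text \<open>
  The matrix \<open>(g\<^sub>i\<^sub>j)\<close> of the round metric, i.e. of the metric induced by the ambient inner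
  product, in stereographic coordinates.
\<close>

definition round_metric :: "real ^ 'n \<Rightarrow> real ^ 'n ^ 'n" where
  "round_metric x = (\<chi> i j.
     frechet_derivative stereo_inv (at x) (axis i 1) \<bullet>
     frechet_derivative stereo_inv (at x) (axis j 1))"

text \<open>
  The volume element is \<open>sqrt (det g) dx\<close> in a chart. The stereographic chart covers the sphere
  except for the pole \<open>(0, -1)\<close>, which has volume zero, so the volume measure is the image of
  this density.
\<close>

definition sphere_vol :: "((real ^ 'n) \<times> real) measure" where
  "sphere_vol = distr (density lborel (\<lambda>x. ennreal (sqrt (det (round_metric x)))))
     (restrict_space borel (sphere 0 1)) stereo_inv"


subsection \<open>The spaces, as sets of functions\<close>

text \<open>
  Squared norms are taken in \<open>[0,\<infinity>]\<close>, so that their finiteness is meaningful. Functions which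
  agree almost everywhere are identified only later, in the definition of an isomorphism.
\<close>

definition H_energy :: "real \<Rightarrow> ((real ^ 'n) \<times> real \<Rightarrow> real) \<Rightarrow> ennreal" where
  "H_energy \<kappa> u =
     ennreal (c_const CARD('n) / 2) *
       (\<integral>\<^sup>+z. (\<integral>\<^sup>+\<zeta>. ennreal ((u z - u \<zeta>)\<^sup>2 / norm (z - \<zeta>) ^ CARD('n)) \<partial>sphere_vol) \<partial>sphere_vol)
     + ennreal \<kappa> * (\<integral>\<^sup>+z. ennreal ((u z)\<^sup>2) \<partial>sphere_vol)"

definition H_norm :: "real \<Rightarrow> ((real ^ 'n) \<times> real \<Rightarrow> real) \<Rightarrow> real" where
  "H_norm \<kappa> u = sqrt (enn2real (H_energy \<kappa> u))"

text \<open>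
  The completion of the smooth functions on the sphere in the norm \<open>H_norm \<kappa>\<close>, in its concrete
  description as the space of all square integrable functions of finite norm.
\<close>

definition H_space :: "real \<Rightarrow> ((real ^ 'n) \<times> real \<Rightarrow> real) set" where
  "H_space \<kappa> = {u \<in> borel_measurable sphere_vol.
     integrable sphere_vol (\<lambda>z. (u z)\<^sup>2) \<and> H_energy \<kappa> u < \<infinity>}"

definition iota :: "((real ^ 'n) \<times> real \<Rightarrow> real) \<Rightarrow> (real ^ 'n \<Rightarrow> real)" where
  "iota u x = conf_factor x powr (real CARD('n) / 2) * u (stereo_inv x)"

definition D_space :: "real \<Rightarrow> (real ^ 'n \<Rightarrow> real) set" where
  "D_space \<kappa> = iota ` H_space \<kappa>"

text \<open>
  The function \<open>u\<close> is determined by \<open>iota u\<close> on the sphere minus a pole, and hence its norm is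
  determined; the value of \<open>D_norm\<close> is meaningful on \<open>D_space\<close> only.
\<close>

definition D_norm :: "real \<Rightarrow> (real ^ 'n \<Rightarrow> real) \<Rightarrow> real" where
  "D_norm \<kappa> v = (THE r. \<exists>u\<in>H_space \<kappa>. v = iota u \<and> r = H_norm \<kappa> u)"

definition Dlog_energy :: "(real ^ 'n \<Rightarrow> real) \<Rightarrow> ennreal" where
  "Dlog_energy v =
     ennreal (c_const CARD('n) / 2) *
       (\<integral>\<^sup>+x. (\<integral>\<^sup>+y\<in>ball x 1. ennreal ((v x - v y)\<^sup>2 / norm (x - y) ^ CARD('n)) \<partial>lborel) \<partial>lborel)
     + (\<integral>\<^sup>+x. ennreal ((v x)\<^sup>2 * ln (exp 1 + (norm x)\<^sup>2)) \<partial>lborel)"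

definition Dlog_norm :: "(real ^ 'n \<Rightarrow> real) \<Rightarrow> real" where
  "Dlog_norm v = sqrt (enn2real (Dlog_energy v))"

definition Dlog_space :: "(real ^ 'n \<Rightarrow> real) set" where
  "Dlog_space = {v \<in> borel_measurable lborel.
     integrable lborel (\<lambda>x. (v x)\<^sup>2) \<and> Dlog_energy v < \<infinity>}"


subsection \<open>Test functions\<close>

fun C_k :: "nat \<Rightarrow> (real ^ 'n \<Rightarrow> real) \<Rightarrow> bool" where
  "C_k 0 f \<longleftrightarrow> continuous_on UNIV f"
| "C_k (Suc k) f \<longleftrightarrow> f differentiable_on UNIV \<and>
     (\<forall>i. C_k k (\<lambda>x. frechet_derivative f (at x) (axis i 1)))"

definition test_functions :: "(real ^ 'n \<Rightarrow> real) set" where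
  "test_functions = {v. (\<forall>k. C_k k v) \<and> compact (closure {x. v x \<noteq> 0})}"


subsection \<open>Isomorphisms of function spaces modulo equality almost everywhere\<close>

definition ae_class :: "'a measure \<Rightarrow> ('a \<Rightarrow> real) set \<Rightarrow> ('a \<Rightarrow> real) \<Rightarrow> ('a \<Rightarrow> real) set" where
  "ae_class M V f = {g \<in> V. AE x in M. g x = f x}"

text \<open>
  \<open>T\<close> is a linear bijection between the quotients of \<open>V\<close> and \<open>W\<close> by equality almost everywhere,
  bounded and with bounded inverse for the norms induced by \<open>p\<close> and \<open>q\<close>. Linearity and
  boundedness are expressed through arbitrary representatives of the classes.
\<close>

definition ae_isomorphism ::
  "'a measure \<Rightarrow> ('a \<Rightarrow> real) set \<Rightarrow> (('a \<Rightarrow> real) \<Rightarrow> real) \<Rightarrow>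
   'b measure \<Rightarrow> ('b \<Rightarrow> real) set \<Rightarrow> (('b \<Rightarrow> real) \<Rightarrow> real) \<Rightarrow>
   (('a \<Rightarrow> real) set \<Rightarrow> ('b \<Rightarrow> real) set) \<Rightarrow> bool" where
  "ae_isomorphism M V p L W q T \<longleftrightarrow>
     bij_betw T (ae_class M V ` V) (ae_class L W ` W) \<and>
     (\<forall>f\<in>V. \<forall>g\<in>V. \<forall>f'\<in>T (ae_class M V f). \<forall>g'\<in>T (ae_class M V g). \<forall>a b.
        (\<lambda>x. a * f' x + b * g' x) \<in> T (ae_class M V (\<lambda>x. a * f x + b * g x))) \<and>
     (\<exists>C. \<forall>f\<in>V. \<forall>f'\<in>T (ae_class M V f). q f' \<le> C * p f) \<and>
     (\<exists>C. \<forall>f\<in>V. \<forall>f'\<in>T (ae_class M V f). p f \<le> C * q f')"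

end

theory Submission
  imports Defs
begin

text \<open>
  Write \<open>R(x) = sqrt (1 + |x|\<^sup>2)\<close>. Pulling the integrals on the sphere back by the stereographic
  projection turns the squared norm of \<open>u\<close> into
  \<open>c/2 \<integral>\<integral> (v(x) R(x)\<^sup>N - v(y) R(y)\<^sup>N)\<^sup>2 / (R(x) R(y))\<^sup>N / |x - y|\<^sup>N dx dy + \<kappa> \<integral> v\<^sup>2\<close>, where \<open>v = \<iota>(u)\<close>.
  For \<open>|x - y| < 1\<close> the quotient \<open>(R(x) / R(y))\<^sup>N\<close> is bounded and differs from 1 by \<open>O(|x - y|)\<close>, so up to
  a multiple of \<open>\<integral> v\<^sup>2\<close> this part is comparable to the local part of the logarithmic energy. The part
  \<open>|x - y| \<ge> 1\<close> is at most a multiple of \<open>\<integral> v\<^sup>2 ln (e + |x|\<^sup>2)\<close>, since the integral of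
  \<open>(R(x) / R(y))\<^sup>N |x - y|\<^sup>-\<^sup>N\<close> over \<open>|x - y| \<ge> 1\<close> grows logarithmically in \<open>x\<close>. Conversely, the region
  \<open>1 \<le> |y| \<le> |x|/2\<close> alone produces the logarithmic weight, up to a multiple of \<open>\<integral> v\<^sup>2\<close>. Both estimates
  hold in \<open>[0,\<infinity>]\<close> for every Borel function, so the two spaces are equal as sets and the isomorphism
  is the identity.
\<close>

subsection \<open>Radial integrals\<close>

text \<open>The order |x - y|^-N is critical: the kernel just fails to be integrable at the diagonal
  and at infinity. At the diagonal the Lipschitz bound for R supplies a factor |x - y|^2. At
  infinity, R(x)^N times the integral of R(y)^-N |x - y|^-N splits into a piece around y = x and a
  piece around y = 0, each essentially a shell of outer radius comparable to R(x) and each worth a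
  logarithm; beyond that radius the two factors together decay like |x - y|^-2N. For the lower bound
  nothing can be subtracted in [0,\<infinity>], so the weight is first bounded by an integral over
  y, and v(x)^2 is then compared pointwise with the integrand at (x, y) plus an error carrying
  v(y)^2. Integrated in x first, that error gives a constant instead of a logarithm, because for |y|
  at most |x|/2 its kernel decays like |x|^-2N; it costs only L^2 mass. The form of the integrand
  rests on the chord identity |S(x) - S(y)| = 2 |x - y| / (R(x) R(y)) for the inverse stereographic
  projection S.\<close>

lemma ennreal_mult3:
  assumes "0 \<le> c" "0 \<le> s" "0 \<le> t"
  shows "ennreal (c * (s * t)) = ennreal c * (ennreal s * ennreal t)"
  using assms by (simp only: ennreal_mult mult_nonneg_nonneg)

lemma ennreal_lincomb:
  assumes "0 \<le> a" "0 \<le> b" "0 \<le> c" "0 \<le> s" "0 \<le> t"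
  shows "ennreal (a * b + c * (s * t)) = ennreal a * ennreal b + ennreal c * (ennreal s * ennreal t)"
  using assms by (simp only: ennreal_mult ennreal_plus mult_nonneg_nonneg)

text \<open>The image of Lebesgue measure under the norm and the measure with the radial density
  both give mass w b^N to \<open>{..b}\<close> for nonnegative b, with w the volume of the unit
  ball: one by the volume of balls, the other by the fundamental theorem of calculus. Half-lines are
  closed under intersection and generate the Borel sets, so the two measures agree.\<close>

lemma nn_integral_radial:
  fixes f :: "real \<Rightarrow> ennreal"
  assumes [measurable]: "f \<in> borel_measurable borel"
  shows "(\<integral>\<^sup>+x. f (norm (x :: 'a :: euclidean_space)) \<partial>lborel) =
    (\<integral>\<^sup>+r. f r * ennreal (DIM('a) * unit_ball_vol DIM('a) * r ^ (DIM('a) - 1)) * indicator {0..} r \<partial>lborel)"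
proof -
  let ?N = "DIM('a)" and ?w = "unit_ball_vol (real DIM('a))"
  define h where "h r = ennreal (?N * ?w * r ^ (?N - 1)) * indicator {0..} r" for r :: real
  have h[measurable]: "h \<in> borel_measurable borel"
    unfolding h_def by measurable
  have eq: "emeasure (distr lborel borel (norm :: 'a \<Rightarrow> real)) {..b} = emeasure (density lborel h) {..b}" for b
  proof -
    have L: "emeasure (distr lborel borel (norm :: 'a \<Rightarrow> real)) {..b} = emeasure lborel (cball (0::'a) b)"
      by (subst emeasure_distr) (auto intro!: arg_cong[where f = "emeasure lborel"])
    have R: "emeasure (density lborel h) {..b} = (\<integral>\<^sup>+r. ennreal (?N * ?w * r ^ (?N - 1)) * indicator {0..b} r \<partial>lborel)"
      by (subst emeasure_density) (auto intro!: nn_integral_cong simp: h_def split: split_indicator)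
    show ?thesis
    proof (cases "b \<ge> 0")
      case True
      have "(\<integral>\<^sup>+r. ennreal (?N * ?w * r ^ (?N - 1)) * indicator {0..b} r \<partial>lborel)
        = ennreal (?w * b ^ ?N - ?w * 0 ^ ?N)"
        using True
        by (intro nn_integral_FTC_Icc[where F = "\<lambda>r. ?w * r ^ ?N"])
          (auto intro!: derivative_eq_intros)
      then show ?thesis
        unfolding L R using True by (simp add: emeasure_cball)
    next
      case False
      then show ?thesis unfolding L R by simp
    qed
  qed
  have "distr lborel borel (norm :: 'a \<Rightarrow> real) = density lborel h"
  proof (rule measure_eqI_generator_eq[where E = "range atMost" and \<Omega> = UNIV and A = "\<lambda>n. {..real n}"])
    show "Int_stable (range (atMost :: real \<Rightarrow> real set))"
      by (auto simp: Int_stable_def)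
    show "(\<Union>n. {..real n}) = UNIV"
      by (auto intro: real_arch_simple)
    show "emeasure (distr lborel borel (norm :: 'a \<Rightarrow> real)) {..real n} \<noteq> \<infinity>" for n
    proof -
      have "emeasure (distr lborel borel (norm :: 'a \<Rightarrow> real)) {..real n} = emeasure lborel (cball (0::'a) (real n))"
        by (subst emeasure_distr) (auto intro!: arg_cong[where f = "emeasure lborel"])
      then show ?thesis by (simp add: emeasure_cball)
    qed
    show "emeasure (distr lborel borel (norm :: 'a \<Rightarrow> real)) X = emeasure (density lborel h) X"
      if "X \<in> range atMost" for X
      using that eq by auto
    show "sets (distr lborel borel (norm :: 'a \<Rightarrow> real)) = sigma_sets UNIV (range atMost)"
      "sets (density lborel h) = sigma_sets UNIV (range atMost)"
      by (simp_all add: borel_eq_atMost)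
  qed auto
  then have "(\<integral>\<^sup>+r. f r \<partial>distr lborel borel (norm :: 'a \<Rightarrow> real)) = (\<integral>\<^sup>+r. f r \<partial>density lborel h)"
    by simp
  then show ?thesis
    by (simp add: nn_integral_distr nn_integral_density h_def mult_ac)
qed

text \<open>The factor |x|^2 is what a Lipschitz bound supplies against the non-integrable |x|^-N;
  in polar form the integrand is N w r.\<close>

lemma nn_integral_ball_norm_sq_div:
  "(\<integral>\<^sup>+x. ennreal ((norm x)\<^sup>2 / norm x ^ DIM('a)) * indicator (ball 0 1) (x :: 'a) \<partial>lborel)
     = ennreal (DIM('a :: euclidean_space) * unit_ball_vol DIM('a) / 2)"
proof -
  let ?N = "DIM('a)" and ?w = "unit_ball_vol (real DIM('a))"
  have "(\<integral>\<^sup>+x. ennreal ((norm x)\<^sup>2 / norm x ^ ?N) * indicator (ball 0 1) (x :: 'a) \<partial>lborel)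
      = (\<integral>\<^sup>+x. (\<lambda>r. ennreal (r\<^sup>2 / r ^ ?N) * indicator {..<1} r) (norm (x :: 'a)) \<partial>lborel)"
    by (intro nn_integral_cong) (auto split: split_indicator)
  also have "\<dots> = (\<integral>\<^sup>+r. (ennreal (r\<^sup>2 / r ^ ?N) * indicator {..<1} r) *
      ennreal (?N * ?w * r ^ (?N - 1)) * indicator {0..} r \<partial>lborel)"
    by (rule nn_integral_radial) measurable
  also have "\<dots> = (\<integral>\<^sup>+r. ennreal (?N * ?w * r) * indicator {0..1} r \<partial>lborel)"
  \<comment> \<open>The open ball and the interval \<open>{0..1}\<close> differ at r = 1, a null
    set. At r = 0 both sides vanish because 0 / 0 = 0.\<close>
  proof (rule nn_integral_cong_AE, use AE_lborel_singleton[of "1::real"] in eventually_elim)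
    case (elim r)
    have "r\<^sup>2 / r ^ ?N * (?N * ?w * r ^ (?N - 1)) = ?N * ?w * r" if "r > 0"
    proof -
      have "r ^ ?N = r * r ^ (?N - 1)"
        by (metis DIM_positive Suc_diff_1 power_Suc)
      then show ?thesis using that by (simp add: power2_eq_square)
    qed
    then show ?case using elim
      by (cases "r = 0") (auto split: split_indicator simp: ennreal_mult[symmetric])
  qed
  also have "\<dots> = ennreal (?N * ?w * 1\<^sup>2 / 2 - ?N * ?w * 0\<^sup>2 / 2)"
    by (intro nn_integral_FTC_Icc[where F = "\<lambda>r. ?N * ?w * r\<^sup>2 / 2"])
      (auto intro!: derivative_eq_intros)
  finally show ?thesis by simp
qed

text \<open>In polar form |x|^-N becomes N w / r. This is the source of every logarithmic bound
  below.\<close>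

lemma nn_integral_shell_inverse_norm:
  assumes "1 \<le> T"
  shows "(\<integral>\<^sup>+x. ennreal (1 / norm x ^ DIM('a)) * indicator {x. 1 \<le> norm x \<and> norm x \<le> T} (x :: 'a) \<partial>lborel)
     = ennreal (DIM('a :: euclidean_space) * unit_ball_vol DIM('a) * ln T)"
proof -
  let ?N = "DIM('a)" and ?w = "unit_ball_vol (real DIM('a))"
  have "(\<integral>\<^sup>+x. ennreal (1 / norm x ^ ?N) * indicator {x. 1 \<le> norm x \<and> norm x \<le> T} (x :: 'a) \<partial>lborel)
      = (\<integral>\<^sup>+x. (\<lambda>r. ennreal (1 / r ^ ?N) * indicator {1..T} r) (norm (x :: 'a)) \<partial>lborel)"
    by (intro nn_integral_cong) (auto split: split_indicator)
  also have "\<dots> = (\<integral>\<^sup>+r. (ennreal (1 / r ^ ?N) * indicator {1..T} r) *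
      ennreal (?N * ?w * r ^ (?N - 1)) * indicator {0..} r \<partial>lborel)"
    by (rule nn_integral_radial) measurable
  also have "\<dots> = (\<integral>\<^sup>+r. ennreal (?N * ?w * (1 / r)) * indicator {1..T} r \<partial>lborel)"
  proof (rule nn_integral_cong)
    fix r :: real
    have "1 / r ^ ?N * (?N * ?w * r ^ (?N - 1)) = ?N * ?w * (1 / r)" if "r > 0"
    proof -
      have "r ^ ?N = r * r ^ (?N - 1)"
        by (metis DIM_positive Suc_diff_1 power_Suc)
      then show ?thesis using that by simp
    qed
    then show "ennreal (1 / r ^ ?N) * indicator {1..T} r * ennreal (?N * ?w * r ^ (?N - 1)) * indicator {0..} r
        = ennreal (?N * ?w * (1 / r)) * indicator {1..T} r"
      by (auto split: split_indicator simp: ennreal_mult[symmetric])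
  qed
  also have "\<dots> = ennreal (?N * ?w * ln T - ?N * ?w * ln 1)"
    using assms
    by (intro nn_integral_FTC_Icc[where F = "\<lambda>r. ?N * ?w * ln r"])
      (auto intro!: derivative_eq_intros simp: field_simps)
  finally show ?thesis by simp
qed

text \<open>The doubled exponent makes the integral converge at infinity, with a value of order
  s^-N. In both later uses this power cancels an N-th power of R(x) or |y| standing in
  front.\<close>

lemma nn_integral_tail_inverse_norm:
  assumes "0 < s"
  shows "(\<integral>\<^sup>+x. ennreal (1 / norm x ^ (2 * DIM('a))) * indicator {x. s \<le> norm x} (x :: 'a) \<partial>lborel)
     = ennreal (unit_ball_vol DIM('a :: euclidean_space) / s ^ DIM('a))"
proof -
  let ?N = "DIM('a)" and ?w = "unit_ball_vol (real DIM('a))"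
  have "(\<integral>\<^sup>+x. ennreal (1 / norm x ^ (2 * ?N)) * indicator {x. s \<le> norm x} (x :: 'a) \<partial>lborel)
      = (\<integral>\<^sup>+x. (\<lambda>r. ennreal (1 / r ^ (2 * ?N)) * indicator {s..} r) (norm (x :: 'a)) \<partial>lborel)"
    by (intro nn_integral_cong) (auto split: split_indicator)
  also have "\<dots> = (\<integral>\<^sup>+r. (ennreal (1 / r ^ (2 * ?N)) * indicator {s..} r) *
      ennreal (?N * ?w * r ^ (?N - 1)) * indicator {0..} r \<partial>lborel)"
    by (rule nn_integral_radial) measurable
  also have "\<dots> = (\<integral>\<^sup>+r. ennreal (?N * ?w / r ^ Suc ?N) * indicator {s..} r \<partial>lborel)"
  proof (rule nn_integral_cong)
    fix r :: real
    have "1 / r ^ (2 * ?N) * (?N * ?w * r ^ (?N - 1)) = ?N * ?w / r ^ Suc ?N" if "r > 0"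
    proof -
      have "2 * ?N = Suc ?N + (?N - 1)"
        using DIM_positive[where 'a = 'a] by linarith
      then have "r ^ (2 * ?N) = r ^ Suc ?N * r ^ (?N - 1)"
        by (metis power_add)
      then show ?thesis using that by simp
    qed
    then show "ennreal (1 / r ^ (2 * ?N)) * indicator {s..} r * ennreal (?N * ?w * r ^ (?N - 1)) * indicator {0..} r
        = ennreal (?N * ?w / r ^ Suc ?N) * indicator {s..} r"
      using assms by (auto split: split_indicator simp: ennreal_mult[symmetric])
  qed
  also have "\<dots> = ennreal (0 - (- (?w * inverse (s ^ ?N))))"
  proof (rule nn_integral_FTC_atLeast[where F = "\<lambda>r. - (?w * inverse (r ^ ?N))"])
    fix r assume "s \<le> r"
    then have r: "r > 0" using assms by simp
    have "((\<lambda>r. - (?w * inverse (r ^ ?N))) has_real_derivative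
       - (?w * - (inverse (r ^ ?N) * (?N * r ^ (?N - 1)) * inverse (r ^ ?N)))) (at r)"
      using r by (auto intro!: derivative_eq_intros)
    moreover have "- (?w * - (inverse (r ^ ?N) * (?N * r ^ (?N - 1)) * inverse (r ^ ?N))) = ?N * ?w / r ^ Suc ?N"
    proof -
      have "r ^ ?N = r * r ^ (?N - 1)"
        by (metis DIM_positive Suc_diff_1 power_Suc)
      then show ?thesis using r by (simp add: field_simps)
    qed
    ultimately show "((\<lambda>r. - (?w * inverse (r ^ ?N))) has_real_derivative ?N * ?w / r ^ Suc ?N) (at r)"
      by simp
  next
    have "((\<lambda>r::real. inverse (r ^ ?N)) \<longlongrightarrow> 0) at_top"
      by (intro tendsto_inverse_0_at_top filterlim_pow_at_top filterlim_ident) simp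
    then show "((\<lambda>r::real. - (?w * inverse (r ^ ?N))) \<longlongrightarrow> 0) at_top"
      using tendsto_mult_left[of _ 0 at_top "- ?w"] by simp
  qed (use assms in auto)
  finally show ?thesis by (simp add: field_simps)
qed

lemma nn_integral_lborel_reflect:
  fixes f :: "'a :: euclidean_space \<Rightarrow> ennreal"
  assumes [measurable]: "f \<in> borel_measurable borel"
  shows "(\<integral>\<^sup>+y. f (x - y) \<partial>lborel) = (\<integral>\<^sup>+y. f y \<partial>lborel)"
proof -
  have "(\<integral>\<^sup>+y. f y \<partial>lborel) = (\<integral>\<^sup>+y. f y \<partial>density (distr lborel borel (\<lambda>y. x + (-1) *\<^sub>R y)) (\<lambda>_. ennreal (\<bar>-1\<bar> ^ DIM('a))))"
    using lborel_affine[of "-1" x] by simp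
  also have "\<dots> = (\<integral>\<^sup>+y. f (x - y) \<partial>lborel)"
    by (simp add: nn_integral_density nn_integral_distr)
  finally show ?thesis by simp
qed

subsection \<open>Pointwise comparison of the integrands\<close>

text \<open>The Japanese bracket, written R in the overview.\<close>

definition bracket :: "'a :: real_normed_vector \<Rightarrow> real" where
  "bracket x = sqrt (1 + (norm x)\<^sup>2)"

text \<open>Seen as the length of (x, 1), the bracket inherits the triangle inequality and is
  therefore 1-Lipschitz.\<close>

lemma bracket_eq_norm: "bracket x = norm (x, 1 :: real)"
  by (simp add: bracket_def norm_Pair add.commute)

lemma bracket_ge_1: "1 \<le> bracket x"
  by (simp add: bracket_def)

lemma bracket_pos: "0 < bracket x"
  using bracket_ge_1[of x] by linarith

lemma norm_le_bracket: "norm x \<le> bracket x"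
  by (simp add: bracket_def real_le_rsqrt)

lemma bracket_triangle: "bracket x \<le> bracket y + norm (x - y)"
proof -
  have "norm (x, 1 :: real) \<le> norm (y, 1 :: real) + norm ((x, 1 :: real) - (y, 1))"
    by (rule norm_triangle_sub)
  then show ?thesis
    by (simp add: bracket_eq_norm norm_Pair)
qed

lemma abs_bracket_diff_le: "\<bar>bracket x - bracket y\<bar> \<le> norm (x - y)"
  using bracket_triangle[of x y] bracket_triangle[of y x] by (simp add: norm_minus_commute abs_le_iff)

lemma bracket_le_2_norm:
  assumes "1 \<le> norm x"
  shows "bracket x \<le> 2 * norm x"
proof -
  have "1 \<le> (norm x)\<^sup>2"
    using assms by (rule one_le_power)
  then show ?thesis
    unfolding bracket_def by (intro real_le_lsqrt) (simp_all add: power_mult_distrib)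
qed

lemma bracket_near: "norm (x - y) \<le> 1 \<Longrightarrow> bracket x \<le> 2 * bracket y"
  using bracket_triangle[of x y] bracket_ge_1[of y] by linarith

lemma borel_measurable_bracket[measurable]:
  "bracket \<in> borel_measurable (borel :: 'a :: real_normed_vector measure)"
  unfolding bracket_def by measurable

lemma abs_power_minus_one_le:
  fixes q :: real
  assumes "0 \<le> q" "q \<le> 2"
  shows "\<bar>q ^ n - 1\<bar> \<le> 2 ^ n * \<bar>q - 1\<bar>"
proof -
  \<comment> \<open>The constant 2^n - 1 reproduces itself in the induction, as 2 (2^n - 1) + 1 =
    2^(n+1) - 1; with 2^n the step would not close.\<close>
  have "\<bar>q ^ n - 1\<bar> \<le> (2 ^ n - 1) * \<bar>q - 1\<bar>"
  proof (induction n)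
    case (Suc n)
    have "\<bar>q ^ Suc n - 1\<bar> = \<bar>q * (q ^ n - 1) + (q - 1)\<bar>"
      by (simp add: algebra_simps)
    also have "\<dots> \<le> q * \<bar>q ^ n - 1\<bar> + \<bar>q - 1\<bar>"
      using assms abs_triangle_ineq[of "q * (q ^ n - 1)" "q - 1"] by (simp add: abs_mult)
    also have "\<dots> \<le> 2 * ((2 ^ n - 1) * \<bar>q - 1\<bar>) + \<bar>q - 1\<bar>"
      using assms Suc by (intro add_mono mult_mono) auto
    finally show ?case by (simp add: algebra_simps)
  qed simp
  also have "\<dots> \<le> 2 ^ n * \<bar>q - 1\<bar>"
    by (intro mult_right_mono) auto
  finally show ?thesis .
qed

lemma bracket_power_near:
  "norm (x - y) \<le> 1 \<Longrightarrow> bracket x ^ n \<le> 2 ^ n * bracket y ^ n"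
  using power_mono[OF bracket_near, of x y n] bracket_pos[of x] by (simp add: power_mult_distrib)

lemma bracket_ratio_near:
  assumes "norm (x - y) \<le> 1"
  shows "bracket x ^ n / bracket y ^ n \<le> 2 ^ n"
  using bracket_power_near[OF assms, of n] bracket_pos[of y] by (simp add: pos_divide_le_eq)

text \<open>For q = R(x) / R(y) the left side is (q^n - 1)^2 q^-n. Since R is 1-Lipschitz and at
  least 1, |q - 1| is at most |x - y|. The square contributes 4^n and the factor q^-n another 2^n,
  together 8^n.\<close>

lemma bracket_power_diff_near:
  assumes "norm (x - y) \<le> 1"
  shows "(bracket x ^ n - bracket y ^ n)\<^sup>2 / (bracket x ^ n * bracket y ^ n) \<le> 8 ^ n * (norm (x - y))\<^sup>2"
proof -
  define q where "q = bracket x / bracket y"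
  have pos: "0 < bracket x" "0 < bracket y"
    by (rule bracket_pos)+
  have q: "0 \<le> q" "q \<le> 2"
    using pos bracket_near[OF assms] by (simp_all add: q_def pos_divide_le_eq)
  have "\<bar>q - 1\<bar> = \<bar>bracket x - bracket y\<bar> / bracket y"
    using pos by (simp add: q_def abs_div_pos diff_divide_distrib)
  also have "\<dots> \<le> norm (x - y) / 1"
    using bracket_ge_1[of y] abs_bracket_diff_le[of x y] by (intro frac_le) auto
  finally have "2 ^ n * \<bar>q - 1\<bar> \<le> 2 ^ n * norm (x - y)"
    by (intro mult_left_mono) auto
  then have "\<bar>q ^ n - 1\<bar> \<le> 2 ^ n * norm (x - y)"
    using abs_power_minus_one_le[OF q, of n] by (rule order_trans[rotated])
  then have "(q ^ n - 1)\<^sup>2 \<le> (2 ^ n * norm (x - y))\<^sup>2"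
    by (metis abs_ge_zero power2_abs power_mono)
  moreover have "bracket y ^ n / bracket x ^ n \<le> 2 ^ n"
    using assms by (intro bracket_ratio_near) (simp add: norm_minus_commute)
  ultimately have "(q ^ n - 1)\<^sup>2 * (bracket y ^ n / bracket x ^ n) \<le> (2 ^ n * norm (x - y))\<^sup>2 * 2 ^ n"
    using pos by (intro mult_mono) auto
  also have "(2 ^ n * norm (x - y))\<^sup>2 * 2 ^ n = 8 ^ n * (norm (x - y))\<^sup>2"
  proof -
    have "(8 :: real) ^ n = 2 ^ n * 2 ^ n * 2 ^ n"
      by (simp only: flip: power_mult_distrib) simp
    then show ?thesis by (simp add: power2_eq_square)
  qed
  also have "(q ^ n - 1)\<^sup>2 * (bracket y ^ n / bracket x ^ n)
      = (bracket x ^ n - bracket y ^ n)\<^sup>2 / (bracket x ^ n * bracket y ^ n)"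
  proof -
    have "(a / b - 1)\<^sup>2 * (b / a) = (a - b)\<^sup>2 / (a * b)" if "a > 0" "b > 0" for a b :: real
    proof -
      have "a / b - 1 = (a - b) / b"
        using that by (simp add: diff_divide_distrib)
      then show ?thesis using that by (simp add: power2_eq_square)
    qed
    from this[of "bracket x ^ n" "bracket y ^ n"] show ?thesis
      using pos by (simp add: q_def power_divide)
  qed
  finally show ?thesis .
qed

text \<open>
  The numerator of the integrand above. Since \<open>R(x)\<^sup>2 = 2 / conf_factor x\<close>, the values \<open>v x * R(x)\<^sup>n\<close> are
  those of \<open>u\<close>, up to a constant factor.
\<close>

definition conf_diff :: "nat \<Rightarrow> ('a :: real_normed_vector \<Rightarrow> real) \<Rightarrow> 'a \<Rightarrow> 'a \<Rightarrow> real" where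
  "conf_diff n v x y = (v x * bracket x ^ n - v y * bracket y ^ n)\<^sup>2 / (bracket x ^ n * bracket y ^ n)"

lemma conf_diff_nonneg: "0 \<le> conf_diff n v x y"
  using bracket_pos[of x] bracket_pos[of y] by (simp add: conf_diff_def)

lemma square_add_le: "((a :: real) + b)\<^sup>2 \<le> 2 * a\<^sup>2 + 2 * b\<^sup>2"
  using zero_le_power2[of "a - b"] by (simp add: power2_eq_square algebra_simps)

text \<open>Write v(x) A - v(y) B = (v(x) - v(y)) A + v(y) (A - B) with A, B the n-th powers of the
  brackets. After division by A B the first square carries A / B, at most 2^n, and the second is
  controlled by \<open>bracket_power_diff_near\<close>.\<close>

lemma conf_diff_le_near:
  assumes "norm (x - y) \<le> 1"
  shows "conf_diff n v x y \<le> 2 * 2 ^ n * (v x - v y)\<^sup>2 + 2 * 8 ^ n * (norm (x - y))\<^sup>2 * (v y)\<^sup>2"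
proof -
  define A B where "A = bracket x ^ n" and "B = bracket y ^ n"
  have pos: "A > 0" "B > 0"
    by (simp_all add: A_def B_def bracket_pos)
  have "(v x * A - v y * B)\<^sup>2 \<le> 2 * ((v x - v y) * A)\<^sup>2 + 2 * (v y * (A - B))\<^sup>2"
  proof -
    have "v x * A - v y * B = (v x - v y) * A + v y * (A - B)"
      by (simp add: algebra_simps)
    then show ?thesis using square_add_le by metis
  qed
  then have "conf_diff n v x y \<le> (2 * ((v x - v y) * A)\<^sup>2 + 2 * (v y * (A - B))\<^sup>2) / (A * B)"
    unfolding conf_diff_def A_def[symmetric] B_def[symmetric]
    using pos by (intro divide_right_mono) auto
  also have "\<dots> = 2 * (v x - v y)\<^sup>2 * (A / B) + 2 * (v y)\<^sup>2 * ((A - B)\<^sup>2 / (A * B))"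
    using pos by (simp add: add_divide_distrib power2_eq_square mult_ac)
  also have "\<dots> \<le> 2 * (v x - v y)\<^sup>2 * 2 ^ n + 2 * (v y)\<^sup>2 * (8 ^ n * (norm (x - y))\<^sup>2)"
    using bracket_ratio_near[OF assms, of n] bracket_power_diff_near[OF assms, of n]
    by (intro add_mono mult_left_mono) (auto simp: A_def B_def)
  finally show ?thesis by (simp add: mult_ac)
qed

text \<open>The same splitting, solved for the increment of v. Dividing by A B leaves a factor A / B
  on the left, which is removed at the price of another 2^n.\<close>

lemma diff_square_le_near:
  assumes "norm (x - y) \<le> 1"
  shows "(v x - v y)\<^sup>2 \<le> 2 ^ n * (2 * conf_diff n v x y + 2 * 8 ^ n * (norm (x - y))\<^sup>2 * (v y)\<^sup>2)"
proof -
  define A B where "A = bracket x ^ n" and "B = bracket y ^ n"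
  have pos: "A > 0" "B > 0"
    by (simp_all add: A_def B_def bracket_pos)
  have "((v x - v y) * A)\<^sup>2 \<le> 2 * (v x * A - v y * B)\<^sup>2 + 2 * (v y * (A - B))\<^sup>2"
  proof -
    have "(v x - v y) * A = (v x * A - v y * B) + - (v y * (A - B))"
      by (simp add: algebra_simps)
    then show ?thesis using square_add_le by (metis power2_minus)
  qed
  then have "((v x - v y) * A)\<^sup>2 / (A * B) \<le> (2 * (v x * A - v y * B)\<^sup>2 + 2 * (v y * (A - B))\<^sup>2) / (A * B)"
    using pos by (intro divide_right_mono) auto
  also have "\<dots> = 2 * conf_diff n v x y + 2 * (v y)\<^sup>2 * ((A - B)\<^sup>2 / (A * B))"
    unfolding conf_diff_def A_def[symmetric] B_def[symmetric]
    by (simp add: add_divide_distrib power_mult_distrib)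
  also have "\<dots> \<le> 2 * conf_diff n v x y + 2 * (v y)\<^sup>2 * (8 ^ n * (norm (x - y))\<^sup>2)"
    using bracket_power_diff_near[OF assms, of n]
    by (intro add_mono mult_left_mono) (auto simp: A_def B_def)
  finally have *: "((v x - v y) * A)\<^sup>2 / (A * B) \<le> 2 * conf_diff n v x y + 2 * 8 ^ n * (norm (x - y))\<^sup>2 * (v y)\<^sup>2"
    by (simp add: mult_ac)
  have "B / A \<le> 2 ^ n"
    using bracket_ratio_near[of y x n] assms by (simp add: A_def B_def norm_minus_commute)
  then have "(B / A) * (((v x - v y) * A)\<^sup>2 / (A * B))
      \<le> 2 ^ n * (2 * conf_diff n v x y + 2 * 8 ^ n * (norm (x - y))\<^sup>2 * (v y)\<^sup>2)"
    using pos by (intro mult_mono *) simp_all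
  moreover have "(B / A) * (((v x - v y) * A)\<^sup>2 / (A * B)) = (v x - v y)\<^sup>2"
    using pos by (simp add: power2_eq_square)
  ultimately show ?thesis by simp
qed

lemma conf_diff_le_far:
  "conf_diff n v x y \<le> 2 * (v x)\<^sup>2 * (bracket x ^ n / bracket y ^ n) + 2 * (v y)\<^sup>2 * (bracket y ^ n / bracket x ^ n)"
proof -
  define A B where "A = bracket x ^ n" and "B = bracket y ^ n"
  have pos: "A > 0" "B > 0"
    by (simp_all add: A_def B_def bracket_pos)
  have "conf_diff n v x y \<le> (2 * (v x * A)\<^sup>2 + 2 * (v y * B)\<^sup>2) / (A * B)"
    unfolding conf_diff_def A_def[symmetric] B_def[symmetric]
    using pos square_add_le[of "v x * A" "- (v y * B)"] by (intro divide_right_mono) auto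
  also have "\<dots> = 2 * (v x)\<^sup>2 * (A / B) + 2 * (v y)\<^sup>2 * (B / A)"
    using pos by (simp add: add_divide_distrib power2_eq_square)
  finally show ?thesis by (simp add: A_def B_def)
qed

text \<open>This is the pointwise substitute for subtraction: v(x) is recovered from the difference,
  and the error is charged to v(y), with the transposed ratio of brackets.\<close>

lemma square_le_conf_diff:
  "(v x)\<^sup>2 * (bracket x ^ n / bracket y ^ n) \<le> 2 * conf_diff n v x y + 2 * (v y)\<^sup>2 * (bracket y ^ n / bracket x ^ n)"
proof -
  define A B where "A = bracket x ^ n" and "B = bracket y ^ n"
  have pos: "A > 0" "B > 0"
    by (simp_all add: A_def B_def bracket_pos)
  have "(v x)\<^sup>2 * (A / B) = (v x * A)\<^sup>2 / (A * B)"
    using pos by (simp add: power2_eq_square)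
  also have "\<dots> \<le> (2 * (v x * A - v y * B)\<^sup>2 + 2 * (v y * B)\<^sup>2) / (A * B)"
    using pos square_add_le[of "v x * A - v y * B" "v y * B"] by (intro divide_right_mono) auto
  also have "\<dots> = 2 * conf_diff n v x y + 2 * (v y)\<^sup>2 * (B / A)"
    unfolding conf_diff_def A_def[symmetric] B_def[symmetric]
    using pos by (simp add: add_divide_distrib power2_eq_square)
  finally show ?thesis by (simp add: A_def B_def)
qed

text \<open>R(x) is at most R(y) + |x - y|, so its n-th power is absorbed by one of the two
  denominators, up to 2^n. What remains is one term centred at x and one centred at 0.\<close>

lemma kernel_le_far:
  assumes "x \<noteq> y"
  shows "bracket x ^ n / bracket y ^ n / norm (x - y) ^ n \<le> 2 ^ n * (1 / norm (x - y) ^ n + 1 / bracket y ^ n)"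
proof -
  let ?d = "norm (x - y)"
  have pos: "?d > 0" "bracket y > 0"
    using assms bracket_pos by auto
  have "bracket x ^ n \<le> (bracket y + ?d) ^ n"
    using bracket_triangle[of x y] bracket_pos[of x] by (intro power_mono) auto
  also have "\<dots> \<le> (2 * max (bracket y) ?d) ^ n"
    using pos by (intro power_mono) auto
  also have "\<dots> = 2 ^ n * max (bracket y) ?d ^ n"
    by (simp add: power_mult_distrib)
  also have "\<dots> \<le> 2 ^ n * (bracket y ^ n + ?d ^ n)"
    using pos by (intro mult_left_mono) (auto simp: max_def)
  finally have "bracket x ^ n / (bracket y ^ n * ?d ^ n) \<le> 2 ^ n * (bracket y ^ n + ?d ^ n) / (bracket y ^ n * ?d ^ n)"
    using pos by (intro divide_right_mono) auto
  also have "\<dots> = 2 ^ n * (1 / ?d ^ n + 1 / bracket y ^ n)"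
    using pos by (simp add: field_simps)
  finally show ?thesis by simp
qed

text \<open>So far from x, the point y is comparable to x - y: |x - y| is at most R(x) + R(y), of
  which R(x) takes at most half. Hence R(y)^-n decays like |x - y|^-n and the exponent
  doubles.\<close>

lemma kernel_le_tail:
  assumes "2 * bracket x \<le> norm (x - y)"
  shows "bracket x ^ n / bracket y ^ n / norm (x - y) ^ n \<le> 2 ^ n * bracket x ^ n * (1 / norm (x - y) ^ (2 * n))"
proof -
  let ?d = "norm (x - y)"
  have d: "?d > 0"
    using assms bracket_pos[of x] by linarith
  have "?d \<le> 2 * bracket y"
    using assms norm_triangle_ineq4[of x y] norm_le_bracket[of x] norm_le_bracket[of y] by linarith
  then have "?d ^ n \<le> 2 ^ n * bracket y ^ n"
    using power_mono[of ?d "2 * bracket y" n] by (simp add: power_mult_distrib)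
  then have "1 / bracket y ^ n \<le> 2 ^ n / ?d ^ n"
    using d bracket_pos[of y] by (simp add: field_simps)
  then have "bracket x ^ n / ?d ^ n * (1 / bracket y ^ n) \<le> bracket x ^ n / ?d ^ n * (2 ^ n / ?d ^ n)"
    using bracket_pos[of x] d by (intro mult_left_mono) (auto simp: less_imp_le)
  then show ?thesis
    by (simp add: mult_ac power_add mult_2_right)
qed

text \<open>In this region |x - y| is at most 2 R(x), so the factor R(x)^n cancels the decay of the
  kernel and only R(y)^-n is left, which produces the logarithm on integration in y.\<close>

lemma inverse_bracket_le_kernel:
  assumes "1 \<le> norm y" "2 * norm y \<le> norm x"
  shows "1 / bracket y ^ n \<le> 2 ^ n * (bracket x ^ n / bracket y ^ n / norm (x - y) ^ n)"
proof -
  let ?d = "norm (x - y)"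
  have d: "?d > 0"
    using assms by auto
  have "?d \<le> 2 * bracket x"
    using assms norm_triangle_ineq4[of x y] norm_le_bracket[of x] by linarith
  then have "?d ^ n \<le> 2 ^ n * bracket x ^ n"
    using power_mono[of ?d "2 * bracket x" n] by (simp add: power_mult_distrib)
  then show ?thesis
    using d bracket_pos[of y] by (simp add: field_simps)
qed

text \<open>The transposed kernel on the same region, where |x| is at most 2 |x - y| and R(y) at
  most 2 |y|. It decays like |x|^-2n, so it can be integrated in x over all of |x| at least 2
  |y|.\<close>

lemma kernel_le_log:
  assumes "1 \<le> norm y" "2 * norm y \<le> norm x"
  shows "bracket y ^ n / bracket x ^ n / norm (x - y) ^ n \<le> 4 ^ n * norm y ^ n * (1 / norm x ^ (2 * n))"
proof -
  let ?d = "norm (x - y)"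
  have pos: "?d > 0" "norm x > 0" "norm y > 0"
    using assms by auto
  have "norm x \<le> 2 * ?d"
    using assms norm_triangle_ineq2[of x y] by linarith
  have "bracket y ^ n \<le> (2 * norm y) ^ n"
    using bracket_le_2_norm assms bracket_pos[of y] by (intro power_mono) auto
  moreover have "norm x ^ n \<le> bracket x ^ n"
    by (intro power_mono norm_le_bracket) auto
  moreover have "(norm x / 2) ^ n \<le> ?d ^ n"
    using \<open>norm x \<le> 2 * ?d\<close> by (intro power_mono) auto
  ultimately have "bracket y ^ n / bracket x ^ n / ?d ^ n \<le> (2 * norm y) ^ n / norm x ^ n / (norm x / 2) ^ n"
    using pos by (intro frac_le zero_le_power mult_nonneg_nonneg divide_nonneg_pos zero_less_power) simp_all
  also have "\<dots> = (2 ^ n * 2 ^ n) * norm y ^ n * (1 / norm x ^ (2 * n))"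
  proof -
    have "norm x ^ (2 * n) = norm x ^ n * norm x ^ n"
      by (simp add: mult_2 power_add)
    then show ?thesis by (simp only: power_mult_distrib power_divide) simp
  qed
  also have "(2 ^ n * 2 ^ n :: real) = 4 ^ n"
    by (simp only: flip: power_mult_distrib) simp
  finally show ?thesis .
qed

lemma conf_diff_measurable[measurable]:
  fixes v :: "'a :: euclidean_space \<Rightarrow> real"
  assumes [measurable]: "v \<in> borel_measurable borel" "f \<in> borel_measurable M" "g \<in> borel_measurable M"
  shows "(\<lambda>w. conf_diff n v (f w) (g w)) \<in> borel_measurable M"
  unfolding conf_diff_def by measurable

subsection \<open>Comparison of the energies\<close>

lemma nn_integral_near_kernel:
  fixes y :: "'a :: euclidean_space"
  shows "(\<integral>\<^sup>+x. ennreal ((norm (x - y))\<^sup>2 / norm (x - y) ^ DIM('a)) * indicator {z. norm z < 1} (x - y) \<partial>lborel)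
    = ennreal (DIM('a) * unit_ball_vol DIM('a) / 2)"
proof -
  let ?f = "\<lambda>z :: 'a. ennreal ((norm z)\<^sup>2 / norm z ^ DIM('a)) * indicator {z. norm z < 1} z"
  have "(\<integral>\<^sup>+x. ?f (x - y) \<partial>lborel) = (\<integral>\<^sup>+x. ?f (y - x) \<partial>lborel)"
    by (intro nn_integral_cong) (simp add: norm_minus_commute split: split_indicator)
  also have "\<dots> = (\<integral>\<^sup>+z. ?f z \<partial>lborel)"
    by (rule nn_integral_lborel_reflect) measurable
  also have "\<dots> = (\<integral>\<^sup>+z. ennreal ((norm z)\<^sup>2 / norm z ^ DIM('a)) * indicator (ball 0 1) (z :: 'a) \<partial>lborel)"
    by (intro nn_integral_cong) (auto split: split_indicator)
  finally show ?thesis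
    by (simp only: nn_integral_ball_norm_sq_div)
qed

lemma one_le_ln_exp_1_add: "1 \<le> ln (exp 1 + t\<^sup>2)" for t :: real
proof -
  have "ln (exp 1) \<le> ln (exp 1 + t\<^sup>2)"
    by (rule ln_mono) auto
  then show ?thesis by simp
qed

text \<open>Up to distance 2 R(x) from x, \<open>kernel_le_far\<close> leaves two inverse N-th
  powers over shells, each contributing about ln R(x). Beyond it, \<open>kernel_le_tail\<close>
  applies and the factor R(x)^N in front cancels against the tail integral.\<close>

lemma nn_integral_far_kernel_le:
  fixes x :: "'a :: euclidean_space"
  shows "(\<integral>\<^sup>+y. ennreal (bracket x ^ DIM('a) / bracket y ^ DIM('a) / norm (x - y) ^ DIM('a)) *
      indicator {z. 1 \<le> norm z} (x - y) \<partial>lborel)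
    \<le> ennreal (2 ^ DIM('a) * unit_ball_vol DIM('a) * (5 * DIM('a) + 2) * ln (exp 1 + (norm x)\<^sup>2))"
    (is "?J \<le> _")
proof -
  let ?N = "DIM('a)" and ?w = "unit_ball_vol (real DIM('a))" and ?R = "bracket x"
  have R: "?R \<ge> 1" by (rule bracket_ge_1)
  have w: "?w \<ge> 0" by simp
  \<comment> \<open>\<open>f1\<close> is the piece around y = x, \<open>f2\<close> and
    \<open>f3\<close> are the unit ball and the shell around y = 0, and \<open>f4\<close> is the
    tail.\<close>
  define f1 where "f1 z = ennreal (1 / norm z ^ ?N) * indicator {z. 1 \<le> norm z \<and> norm z \<le> 2 * ?R} z" for z :: 'a
  define f2 where "f2 = (indicator (cball 0 1) :: 'a \<Rightarrow> ennreal)"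
  define f3 where "f3 z = ennreal (1 / norm z ^ ?N) * indicator {z. 1 \<le> norm z \<and> norm z \<le> 3 * ?R} z" for z :: 'a
  define f4 where "f4 z = ennreal (1 / norm z ^ (2 * ?N)) * indicator {z. 2 * ?R \<le> norm z} z" for z :: 'a
  have [measurable]: "f1 \<in> borel_measurable borel" "f3 \<in> borel_measurable borel" "f4 \<in> borel_measurable borel"
    unfolding f1_def f3_def f4_def by measurable
  have [measurable]: "f2 \<in> borel_measurable borel"
    unfolding f2_def by (intro borel_measurable_indicator borel_closed) simp
  have "?J \<le> (\<integral>\<^sup>+y. ennreal (2 ^ ?N) * (f1 (x - y) + (f2 y + f3 y)) + ennreal (2 ^ ?N * ?R ^ ?N) * f4 (x - y) \<partial>lborel)"
  proof (rule nn_integral_mono)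
    fix y
    let ?d = "norm (x - y)" and ?k = "bracket x ^ ?N / bracket y ^ ?N / norm (x - y) ^ ?N"
    consider "?d < 1" | "1 \<le> ?d" "?d \<le> 2 * ?R" | "2 * ?R \<le> ?d" "1 \<le> ?d" by linarith
    then show "ennreal ?k * indicator {z. 1 \<le> norm z} (x - y)
      \<le> ennreal (2 ^ ?N) * (f1 (x - y) + (f2 y + f3 y)) + ennreal (2 ^ ?N * ?R ^ ?N) * f4 (x - y)"
    proof cases
      case 1
      then show ?thesis by simp
    next
      case 2
      \<comment> \<open>The outer radius in \<open>f3\<close>: |y| is at most |x| + |x - y|, with
        |x| at most R(x) and |x - y| at most 2 R(x).\<close>
      have y3: "norm y \<le> 3 * ?R"
        using 2 norm_le_bracket[of x] norm_triangle_ineq4[of x "x - y"] by simp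
      have h1: "ennreal (1 / bracket y ^ ?N) \<le> f2 y + f3 y"
      proof (cases "norm y \<le> 1")
        case True
        have "1 / bracket y ^ ?N \<le> 1"
          using bracket_ge_1[of y] by simp
        then show ?thesis using True by (simp add: f2_def add_increasing2)
      next
        case False
        have "1 / bracket y ^ ?N \<le> 1 / norm y ^ ?N"
          using False norm_le_bracket[of y] by (intro divide_left_mono power_mono mult_pos_pos zero_less_power bracket_pos) auto
        then show ?thesis using False y3 by (simp add: f2_def f3_def ennreal_leI)
      qed
      have h2: "f1 (x - y) = ennreal (1 / ?d ^ ?N)"
        using 2 by (simp add: f1_def)
      have "ennreal ?k \<le> ennreal (2 ^ ?N * (1 / ?d ^ ?N + 1 / bracket y ^ ?N))"
        using 2 by (intro ennreal_leI kernel_le_far) auto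
      also have "\<dots> = ennreal (2 ^ ?N) * (ennreal (1 / ?d ^ ?N) + ennreal (1 / bracket y ^ ?N))"
        using bracket_pos[of y] by (subst ennreal_mult) (auto simp: less_imp_le)
      also have "\<dots> \<le> ennreal (2 ^ ?N) * (f1 (x - y) + (f2 y + f3 y))"
        unfolding h2 by (intro mult_left_mono add_left_mono h1) simp
      also have "\<dots> \<le> \<dots> + ennreal (2 ^ ?N * ?R ^ ?N) * f4 (x - y)"
        by simp
      finally have *: "ennreal ?k \<le> ennreal (2 ^ ?N) * (f1 (x - y) + (f2 y + f3 y)) + ennreal (2 ^ ?N * ?R ^ ?N) * f4 (x - y)" .
      have "ennreal ?k * indicator {z. 1 \<le> norm z} (x - y) = ennreal ?k"
        using 2 by simp
      then show ?thesis using * by (simp only:)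
    next
      case 3
      have "ennreal ?k \<le> ennreal (2 ^ ?N * ?R ^ ?N * (1 / ?d ^ (2 * ?N)))"
        using 3 by (intro ennreal_leI kernel_le_tail) auto
      also have "\<dots> = ennreal (2 ^ ?N * ?R ^ ?N) * f4 (x - y)"
        using 3 R by (simp add: f4_def ennreal_mult[symmetric])
      finally show ?thesis using 3 by (simp add: add_increasing)
    qed
  qed
  also have "\<dots> = ennreal (2 ^ ?N) * ((\<integral>\<^sup>+y. f1 (x - y) \<partial>lborel) + ((\<integral>\<^sup>+y. f2 y \<partial>lborel) + (\<integral>\<^sup>+y. f3 y \<partial>lborel)))
      + ennreal (2 ^ ?N * ?R ^ ?N) * (\<integral>\<^sup>+y. f4 (x - y) \<partial>lborel)"
    by (simp add: nn_integral_add nn_integral_cmult)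
  also have "(\<integral>\<^sup>+y. f1 (x - y) \<partial>lborel) = (\<integral>\<^sup>+y. f1 y \<partial>lborel)"
    by (rule nn_integral_lborel_reflect) measurable
  also have "(\<integral>\<^sup>+y. f4 (x - y) \<partial>lborel) = (\<integral>\<^sup>+y. f4 y \<partial>lborel)"
    by (rule nn_integral_lborel_reflect) measurable
  also have "(\<integral>\<^sup>+y. f1 y \<partial>lborel) = ennreal (?N * ?w * ln (2 * ?R))"
    unfolding f1_def f3_def using R by (intro nn_integral_shell_inverse_norm) simp
  also have "(\<integral>\<^sup>+y. f3 y \<partial>lborel) = ennreal (?N * ?w * ln (3 * ?R))"
    unfolding f1_def f3_def using R by (intro nn_integral_shell_inverse_norm) simp
  also have "(\<integral>\<^sup>+y. f4 y \<partial>lborel) = ennreal (?w / (2 * ?R) ^ ?N)"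
    unfolding f4_def using R by (intro nn_integral_tail_inverse_norm) simp
  also have "(\<integral>\<^sup>+y. f2 y \<partial>lborel) = ennreal ?w"
    by (simp add: f2_def emeasure_cball)
  also have "ennreal (2 ^ ?N) * (ennreal (?N * ?w * ln (2 * ?R)) + (ennreal ?w + ennreal (?N * ?w * ln (3 * ?R))))
      + ennreal (2 ^ ?N * ?R ^ ?N) * ennreal (?w / (2 * ?R) ^ ?N)
    = ennreal (2 ^ ?N * (?N * ?w * ln (2 * ?R) + (?w + ?N * ?w * ln (3 * ?R))) + 2 ^ ?N * ?R ^ ?N * (?w / (2 * ?R) ^ ?N))"
    using R w by (simp add: ennreal_plus[symmetric] ennreal_mult[symmetric] del: ennreal_plus)
  \<comment> \<open>Let l be the weight ln (e + |x|^2). Then ln (2 R) is at most 2 l and ln (3 R) at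
    most 3 l, which gives 5 N; the unit ball and the tail contribute 1 each, which gives the
    2.\<close>
  also have "\<dots> \<le> ennreal (2 ^ ?N * ?w * (5 * ?N + 2) * ln (exp 1 + (norm x)\<^sup>2))"
  proof (rule ennreal_leI)
    let ?l = "ln (exp 1 + (norm x)\<^sup>2)"
    have l1: "1 \<le> ?l" by (rule one_le_ln_exp_1_add)
    have "2 * ln ?R = ln (1 + (norm x)\<^sup>2)"
      by (simp add: bracket_def ln_sqrt)
    also have "\<dots> \<le> ?l"
      by (subst ln_le_cancel_iff) (auto intro: add_pos_nonneg)
    finally have lR: "2 * ln ?R \<le> ?l" .
    have l2: "ln (2 * ?R) \<le> 2 * ?l"
      using R lR l1 ln_le_minus_one[of 2] by (simp add: ln_mult)
    have l3: "ln (3 * ?R) \<le> 3 * ?l"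
      using R lR l1 ln_le_minus_one[of 3] by (simp add: ln_mult)
    have "2 ^ ?N * ?R ^ ?N * (?w / (2 * ?R) ^ ?N) = ?w"
      using R by (simp add: power_mult_distrib)
    also have "\<dots> \<le> 2 ^ ?N * ?w * ?l"
      using l1 w mult_mono[of 1 "2 ^ ?N" 1 ?l] mult_right_mono[of 1 "2 ^ ?N * ?l" ?w] by (simp add: mult_ac)
    finally have a: "2 ^ ?N * ?R ^ ?N * (?w / (2 * ?R) ^ ?N) \<le> 2 ^ ?N * ?w * ?l" .
    have "?N * ?w * ln (2 * ?R) + (?w + ?N * ?w * ln (3 * ?R)) \<le> ?N * ?w * (2 * ?l) + (?w * ?l + ?N * ?w * (3 * ?l))"
      using l1 l2 l3 w mult_left_mono[OF l1 w] by (intro add_mono mult_left_mono) auto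
    then have "2 ^ ?N * (?N * ?w * ln (2 * ?R) + (?w + ?N * ?w * ln (3 * ?R)))
      \<le> 2 ^ ?N * (?N * ?w * (2 * ?l) + (?w * ?l + ?N * ?w * (3 * ?l)))"
      by (rule mult_left_mono) simp
    with a have "2 ^ ?N * (?N * ?w * ln (2 * ?R) + (?w + ?N * ?w * ln (3 * ?R))) + 2 ^ ?N * ?R ^ ?N * (?w / (2 * ?R) ^ ?N)
      \<le> 2 ^ ?N * (?N * ?w * (2 * ?l) + (?w * ?l + ?N * ?w * (3 * ?l))) + 2 ^ ?N * ?w * ?l"
      by (rule add_mono[rotated])
    also have "\<dots> = 2 ^ ?N * ?w * (5 * ?N + 2) * ?l"
      by (simp add: algebra_simps)
    finally show "2 ^ ?N * (?N * ?w * ln (2 * ?R) + (?w + ?N * ?w * ln (3 * ?R))) + 2 ^ ?N * ?R ^ ?N * (?w / (2 * ?R) ^ ?N)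
      \<le> 2 ^ ?N * ?w * (5 * ?N + 2) * ?l" .
  qed
  finally show ?thesis .
qed

text \<open>The shell from 1 to |x|/2 contributes N w ln (|x|/2). For |x| at least 2, e + |x|^2 is
  at most 8 (|x|/2)^2, so the weight is at most ln 8 + 2 ln (|x|/2). The summand 3 bounds ln 8 and
  also covers |x| < 2, where the region of integration is empty. The factor 2^N pays for replacing
  |y| by R(y).\<close>

lemma ln_le_nn_integral_inverse_bracket:
  fixes x :: "'a :: euclidean_space"
  shows "ennreal (ln (exp 1 + (norm x)\<^sup>2)) \<le> 3 + ennreal (2 * 2 ^ DIM('a) / (DIM('a) * unit_ball_vol DIM('a))) *
    (\<integral>\<^sup>+y. ennreal (1 / bracket y ^ DIM('a)) * indicator {y. 1 \<le> norm y \<and> 2 * norm y \<le> norm x} (y :: 'a) \<partial>lborel)"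
proof -
  let ?N = "DIM('a)" and ?w = "unit_ball_vol (real DIM('a))" and ?l = "ln (exp 1 + (norm x)\<^sup>2)"
  have w: "?w > 0" by simp
  have N: "?N > 0" by simp
  have ln8: "ln 8 \<le> (3 :: real)"
  proof -
    have "ln (8 :: real) = ln (2 ^ 3)" by simp
    also have "\<dots> = 3 * ln 2" by (subst ln_realpow) auto
    finally show ?thesis using ln_le_minus_one[of 2] by simp
  qed
  have pos: "exp 1 + (norm x)\<^sup>2 > 0"
    by (intro add_pos_nonneg) auto
  show ?thesis
  proof (cases "norm x < 2")
    case True
    have "(norm x)\<^sup>2 \<le> 2\<^sup>2"
      using True by (intro power_mono) auto
    then have "exp 1 + (norm x)\<^sup>2 \<le> 8"
      using exp_le by simp
    then have "?l \<le> ln 8"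
      using pos by (rule ln_mono)
    then have "ennreal ?l \<le> 3"
      using ln8 ennreal_leI[of ?l 3] by simp
    then show ?thesis by (rule order_trans) simp
  next
    case False
    then have x2: "norm x / 2 \<ge> 1" by simp
    have "2\<^sup>2 \<le> (norm x)\<^sup>2"
      using False by (intro power_mono) auto
    then have "exp 1 + (norm x)\<^sup>2 \<le> 8 * (norm x / 2)\<^sup>2"
      using exp_le by (simp add: power_divide)
    then have "?l \<le> ln (8 * (norm x / 2)\<^sup>2)"
      using pos by (rule ln_mono)
    also have "\<dots> = ln 8 + 2 * ln (norm x / 2)"
      using False by (subst ln_mult) (auto simp: ln_realpow)
    finally have "?l \<le> 3 + 2 * ln (norm x / 2)"
      using ln8 by simp
    then have "ennreal ?l \<le> ennreal (3 + 2 * ln (norm x / 2))"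
      by (rule ennreal_leI)
    also have "\<dots> = 3 + ennreal (2 * 2 ^ ?N / (?N * ?w)) * (ennreal (1 / 2 ^ ?N) * ennreal (?N * ?w * ln (norm x / 2)))"
    proof -
      have "?w \<noteq> 0" using w by linarith
      then show ?thesis using x2 by (simp add: ennreal_mult[symmetric])
    qed
    also have "ennreal (?N * ?w * ln (norm x / 2)) =
        (\<integral>\<^sup>+y. ennreal (1 / norm y ^ ?N) * indicator {y. 1 \<le> norm y \<and> norm y \<le> norm x / 2} (y :: 'a) \<partial>lborel)"
      by (rule nn_integral_shell_inverse_norm[OF x2, symmetric])
    also have "ennreal (1 / 2 ^ ?N) * \<dots> =
        (\<integral>\<^sup>+y. ennreal (1 / 2 ^ ?N) * (ennreal (1 / norm y ^ ?N) * indicator {y. 1 \<le> norm y \<and> norm y \<le> norm x / 2} (y :: 'a)) \<partial>lborel)"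
      by (rule nn_integral_cmult[symmetric]) measurable
    also have "\<dots> \<le> (\<integral>\<^sup>+y. ennreal (1 / bracket y ^ ?N) * indicator {y. 1 \<le> norm y \<and> 2 * norm y \<le> norm x} (y :: 'a) \<partial>lborel)"
    proof (rule nn_integral_mono)
      fix y :: 'a
      have "1 / (2 * norm y) ^ ?N \<le> 1 / bracket y ^ ?N" if "1 \<le> norm y"
        using that bracket_le_2_norm[OF that] bracket_pos[of y]
        by (intro divide_left_mono power_mono mult_pos_pos zero_less_power) auto
      then show "ennreal (1 / 2 ^ ?N) * (ennreal (1 / norm y ^ ?N) * indicator {y. 1 \<le> norm y \<and> norm y \<le> norm x / 2} y)
        \<le> ennreal (1 / bracket y ^ ?N) * indicator {y. 1 \<le> norm y \<and> 2 * norm y \<le> norm x} y"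
        by (auto split: split_indicator simp: ennreal_mult[symmetric] power_mult_distrib intro!: ennreal_leI)
    qed
    finally show ?thesis
      by (simp add: add_left_mono mult_left_mono)
  qed
qed

section \<open>Double integrals and the energies to be compared\<close>

lemma nn_integral2_mono:
  fixes f g :: "'a :: euclidean_space \<Rightarrow> 'a \<Rightarrow> ennreal"
  assumes "\<And>x y. f x y \<le> g x y"
  shows "(\<integral>\<^sup>+x. (\<integral>\<^sup>+y. f x y \<partial>lborel) \<partial>lborel) \<le> (\<integral>\<^sup>+x. (\<integral>\<^sup>+y. g x y \<partial>lborel) \<partial>lborel)"
  by (intro nn_integral_mono assms)

lemma nn_integral2_add:
  fixes f g :: "'a :: euclidean_space \<Rightarrow> 'a \<Rightarrow> ennreal"
  assumes [measurable]: "case_prod f \<in> borel_measurable (lborel \<Otimes>\<^sub>M lborel)"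
    "case_prod g \<in> borel_measurable (lborel \<Otimes>\<^sub>M lborel)"
  shows "(\<integral>\<^sup>+x. (\<integral>\<^sup>+y. f x y + g x y \<partial>lborel) \<partial>lborel)
    = (\<integral>\<^sup>+x. (\<integral>\<^sup>+y. f x y \<partial>lborel) \<partial>lborel) + (\<integral>\<^sup>+x. (\<integral>\<^sup>+y. g x y \<partial>lborel) \<partial>lborel)"
  by (simp add: nn_integral_add)

lemma nn_integral2_cmult:
  fixes f :: "'a :: euclidean_space \<Rightarrow> 'a \<Rightarrow> ennreal"
  assumes [measurable]: "case_prod f \<in> borel_measurable (lborel \<Otimes>\<^sub>M lborel)"
  shows "(\<integral>\<^sup>+x. (\<integral>\<^sup>+y. c * f x y \<partial>lborel) \<partial>lborel) = c * (\<integral>\<^sup>+x. (\<integral>\<^sup>+y. f x y \<partial>lborel) \<partial>lborel)"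
  by (simp add: nn_integral_cmult)

text \<open>The double integral of the sphere in flat coordinates, without the factor c/2;
  \<open>nn_integral_sphere_double\<close> makes the identification.\<close>

definition conf_energy :: "('a :: euclidean_space \<Rightarrow> real) \<Rightarrow> ennreal" where
  "conf_energy v = (\<integral>\<^sup>+x. (\<integral>\<^sup>+y. ennreal (conf_diff DIM('a) v x y / norm (x - y) ^ DIM('a)) \<partial>lborel) \<partial>lborel)"

text \<open>The cutoff is a function of x - y, so that kernel and cutoff are reflected and
  translated together; \<open>Dlog_energy_eq\<close> returns to \<open>ball x 1\<close>.\<close>

definition near_energy :: "('a :: euclidean_space \<Rightarrow> real) \<Rightarrow> ennreal" where
  "near_energy v = (\<integral>\<^sup>+x. (\<integral>\<^sup>+y. ennreal ((v x - v y)\<^sup>2 / norm (x - y) ^ DIM('a)) *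
     indicator {z. norm z < 1} (x - y) \<partial>lborel) \<partial>lborel)"

definition sq_energy :: "('a :: euclidean_space \<Rightarrow> real) \<Rightarrow> ennreal" where
  "sq_energy v = (\<integral>\<^sup>+x. ennreal ((v x)\<^sup>2) \<partial>lborel)"

definition log_energy :: "('a :: euclidean_space \<Rightarrow> real) \<Rightarrow> ennreal" where
  "log_energy v = (\<integral>\<^sup>+x. ennreal ((v x)\<^sup>2 * ln (exp 1 + (norm x)\<^sup>2)) \<partial>lborel)"

lemma sq_energy_le_log_energy: "sq_energy (v :: 'a :: euclidean_space \<Rightarrow> real) \<le> log_energy v"
  unfolding sq_energy_def log_energy_def
proof (intro nn_integral_mono ennreal_leI)
  fix x :: 'a
  show "(v x)\<^sup>2 \<le> (v x)\<^sup>2 * ln (exp 1 + (norm x)\<^sup>2)"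
    using mult_left_mono[OF one_le_ln_exp_1_add, of "(v x)\<^sup>2"] by simp
qed

section \<open>Integrals of the kernels against the square of one value of v\<close>

context
  fixes v :: "'a :: euclidean_space \<Rightarrow> real"
  assumes v[measurable]: "v \<in> borel_measurable borel"
begin

text \<open>The weight sits at y while the kernel depends on x - y only. By Tonelli the integral in
  x can be taken first, and it does not depend on y.\<close>

lemma nn_integral_near_mass:
  "(\<integral>\<^sup>+x. (\<integral>\<^sup>+y. ennreal ((v y)\<^sup>2) * (ennreal ((norm (x - y))\<^sup>2 / norm (x - y) ^ DIM('a)) *
      indicator {z. norm z < 1} (x - y)) \<partial>lborel) \<partial>lborel)
   = ennreal (DIM('a) * unit_ball_vol DIM('a) / 2) * sq_energy v"
proof -
  have "(\<integral>\<^sup>+x. (\<integral>\<^sup>+y. ennreal ((v y)\<^sup>2) * (ennreal ((norm (x - y))\<^sup>2 / norm (x - y) ^ DIM('a)) *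
      indicator {z. norm z < 1} (x - y)) \<partial>lborel) \<partial>lborel)
    = (\<integral>\<^sup>+y. (\<integral>\<^sup>+x. ennreal ((v y)\<^sup>2) * (ennreal ((norm (x - y))\<^sup>2 / norm (x - y) ^ DIM('a)) *
      indicator {z. norm z < 1} (x - y)) \<partial>lborel) \<partial>lborel)"
    by (rule lborel_pair.Fubini'[symmetric]) measurable
  also have "\<dots> = (\<integral>\<^sup>+y. ennreal ((v y)\<^sup>2) * ennreal (DIM('a) * unit_ball_vol DIM('a) / 2) \<partial>lborel)"
  proof (rule nn_integral_cong)
    fix y :: 'a
    have "(\<integral>\<^sup>+x. ennreal ((v y)\<^sup>2) * (ennreal ((norm (x - y))\<^sup>2 / norm (x - y) ^ DIM('a)) *
        indicator {z. norm z < 1} (x - y)) \<partial>lborel)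
      = ennreal ((v y)\<^sup>2) * (\<integral>\<^sup>+x. (ennreal ((norm (x - y))\<^sup>2 / norm (x - y) ^ DIM('a)) *
        indicator {z. norm z < 1} (x - y)) \<partial>lborel)"
      by (rule nn_integral_cmult) measurable
    then show "(\<integral>\<^sup>+x. ennreal ((v y)\<^sup>2) * (ennreal ((norm (x - y))\<^sup>2 / norm (x - y) ^ DIM('a)) *
        indicator {z. norm z < 1} (x - y)) \<partial>lborel) = ennreal ((v y)\<^sup>2) * ennreal (DIM('a) * unit_ball_vol DIM('a) / 2)"
      by (simp only: nn_integral_near_kernel)
  qed
  also have "\<dots> = ennreal (DIM('a) * unit_ball_vol DIM('a) / 2) * sq_energy v"
    unfolding sq_energy_def by (subst nn_integral_cmult[symmetric]) (auto simp: mult.commute)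
  finally show ?thesis .
qed

text \<open>Here the weight sits at x, so the inner integral already is the one that grows
  logarithmically in x.\<close>

lemma nn_integral_far_mass_le:
  "(\<integral>\<^sup>+x. (\<integral>\<^sup>+y. ennreal ((v x)\<^sup>2) * (ennreal (bracket x ^ DIM('a) / bracket y ^ DIM('a) / norm (x - y) ^ DIM('a)) *
      indicator {z. 1 \<le> norm z} (x - y)) \<partial>lborel) \<partial>lborel)
   \<le> ennreal (2 ^ DIM('a) * unit_ball_vol DIM('a) * (5 * DIM('a) + 2)) * log_energy v"
proof -
  let ?C = "2 ^ DIM('a) * unit_ball_vol (real DIM('a)) * (5 * DIM('a) + 2)"
  have "(\<integral>\<^sup>+y. ennreal ((v x)\<^sup>2) * (ennreal (bracket x ^ DIM('a) / bracket y ^ DIM('a) / norm (x - y) ^ DIM('a)) *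
      indicator {z. 1 \<le> norm z} (x - y)) \<partial>lborel) \<le> ennreal ?C * ennreal ((v x)\<^sup>2 * ln (exp 1 + (norm x)\<^sup>2))" for x
  proof -
    have "(\<integral>\<^sup>+y. ennreal ((v x)\<^sup>2) * (ennreal (bracket x ^ DIM('a) / bracket y ^ DIM('a) / norm (x - y) ^ DIM('a)) *
      indicator {z. 1 \<le> norm z} (x - y)) \<partial>lborel)
      = ennreal ((v x)\<^sup>2) * (\<integral>\<^sup>+y. ennreal (bracket x ^ DIM('a) / bracket y ^ DIM('a) / norm (x - y) ^ DIM('a)) *
      indicator {z. 1 \<le> norm z} (x - y) \<partial>lborel)"
      by (rule nn_integral_cmult) measurable
    also have "\<dots> \<le> ennreal ((v x)\<^sup>2) * ennreal (?C * ln (exp 1 + (norm x)\<^sup>2))"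
      by (intro mult_left_mono nn_integral_far_kernel_le) simp
    also have "\<dots> = ennreal ((v x)\<^sup>2 * (?C * ln (exp 1 + (norm x)\<^sup>2)))"
      by (rule ennreal_mult'[symmetric]) simp
    also have "\<dots> = ennreal (?C * ((v x)\<^sup>2 * ln (exp 1 + (norm x)\<^sup>2)))"
      by (simp only: mult_ac)
    also have "\<dots> = ennreal ?C * ennreal ((v x)\<^sup>2 * ln (exp 1 + (norm x)\<^sup>2))"
      by (rule ennreal_mult') simp
    finally show ?thesis .
  qed
  then have "(\<integral>\<^sup>+x. (\<integral>\<^sup>+y. ennreal ((v x)\<^sup>2) * (ennreal (bracket x ^ DIM('a) / bracket y ^ DIM('a) / norm (x - y) ^ DIM('a)) *
      indicator {z. 1 \<le> norm z} (x - y)) \<partial>lborel) \<partial>lborel)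
    \<le> (\<integral>\<^sup>+x. ennreal ?C * ennreal ((v x)\<^sup>2 * ln (exp 1 + (norm x)\<^sup>2)) \<partial>lborel)"
    by (intro nn_integral_mono)
  also have "\<dots> = ennreal ?C * log_energy v"
    unfolding log_energy_def by (rule nn_integral_cmult) measurable
  finally show ?thesis .
qed

text \<open>After exchanging the integrals, \<open>kernel_le_log\<close> reduces the inner one to a
  tail over |x| at least 2 |y|. Its value w / (2 |y|)^N cancels 4^N |y|^N up to 2^N, so no logarithm
  appears.\<close>

lemma nn_integral_log_mass_le:
  "(\<integral>\<^sup>+x. (\<integral>\<^sup>+y. ennreal ((v y)\<^sup>2) * (ennreal (bracket y ^ DIM('a) / bracket x ^ DIM('a) / norm (x - y) ^ DIM('a)) *
      indicator {y. 1 \<le> norm y \<and> 2 * norm y \<le> norm x} y) \<partial>lborel) \<partial>lborel)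
   \<le> ennreal (2 ^ DIM('a) * unit_ball_vol DIM('a)) * sq_energy v"
proof -
  let ?N = "DIM('a)" and ?w = "unit_ball_vol (real DIM('a))"
  have "(\<integral>\<^sup>+x. (\<integral>\<^sup>+y. ennreal ((v y)\<^sup>2) * (ennreal (bracket y ^ ?N / bracket x ^ ?N / norm (x - y) ^ ?N) *
      indicator {y. 1 \<le> norm y \<and> 2 * norm y \<le> norm x} y) \<partial>lborel) \<partial>lborel)
    = (\<integral>\<^sup>+y. (\<integral>\<^sup>+x. ennreal ((v y)\<^sup>2) * (ennreal (bracket y ^ ?N / bracket x ^ ?N / norm (x - y) ^ ?N) *
      indicator {y. 1 \<le> norm y \<and> 2 * norm y \<le> norm x} y) \<partial>lborel) \<partial>lborel)"
    by (rule lborel_pair.Fubini'[symmetric]) measurable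
  also have "\<dots> \<le> (\<integral>\<^sup>+y. ennreal (2 ^ ?N * ?w) * ennreal ((v y)\<^sup>2) \<partial>lborel)"
  proof (rule nn_integral_mono)
    fix y :: 'a
    show "(\<integral>\<^sup>+x. ennreal ((v y)\<^sup>2) * (ennreal (bracket y ^ ?N / bracket x ^ ?N / norm (x - y) ^ ?N) *
      indicator {y. 1 \<le> norm y \<and> 2 * norm y \<le> norm x} y) \<partial>lborel) \<le> ennreal (2 ^ ?N * ?w) * ennreal ((v y)\<^sup>2)"
    proof (cases "1 \<le> norm y")
      case True
      have "(\<integral>\<^sup>+x. ennreal ((v y)\<^sup>2) * (ennreal (bracket y ^ ?N / bracket x ^ ?N / norm (x - y) ^ ?N) *
          indicator {y. 1 \<le> norm y \<and> 2 * norm y \<le> norm x} y) \<partial>lborel)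
        \<le> (\<integral>\<^sup>+x. ennreal ((v y)\<^sup>2 * (4 ^ ?N * norm y ^ ?N)) *
          (ennreal (1 / norm x ^ (2 * ?N)) * indicator {x. 2 * norm y \<le> norm x} (x :: 'a)) \<partial>lborel)"
      proof (rule nn_integral_mono)
        fix x :: 'a
        show "ennreal ((v y)\<^sup>2) * (ennreal (bracket y ^ ?N / bracket x ^ ?N / norm (x - y) ^ ?N) *
            indicator {y. 1 \<le> norm y \<and> 2 * norm y \<le> norm x} y)
          \<le> ennreal ((v y)\<^sup>2 * (4 ^ ?N * norm y ^ ?N)) *
            (ennreal (1 / norm x ^ (2 * ?N)) * indicator {x. 2 * norm y \<le> norm x} x)"
        proof (cases "2 * norm y \<le> norm x")
          case le: True
          have "ennreal ((v y)\<^sup>2) * ennreal (bracket y ^ ?N / bracket x ^ ?N / norm (x - y) ^ ?N)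
            = ennreal ((v y)\<^sup>2 * (bracket y ^ ?N / bracket x ^ ?N / norm (x - y) ^ ?N))"
            by (rule ennreal_mult'[symmetric]) simp
          also have "\<dots> \<le> ennreal ((v y)\<^sup>2 * (4 ^ ?N * norm y ^ ?N * (1 / norm x ^ (2 * ?N))))"
            by (intro ennreal_leI mult_left_mono kernel_le_log True le) simp
          also have "\<dots> = ennreal ((v y)\<^sup>2 * (4 ^ ?N * norm y ^ ?N)) * ennreal (1 / norm x ^ (2 * ?N))"
            by (subst ennreal_mult'[symmetric]) (simp_all add: mult_ac)
          finally show ?thesis using True le by simp
        qed simp
      qed
      also have "\<dots> = ennreal ((v y)\<^sup>2 * (4 ^ ?N * norm y ^ ?N)) *
          (\<integral>\<^sup>+x. (ennreal (1 / norm x ^ (2 * ?N)) * indicator {x. 2 * norm y \<le> norm x} (x :: 'a)) \<partial>lborel)"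
        by (rule nn_integral_cmult) measurable
      also have "(\<integral>\<^sup>+x. (ennreal (1 / norm x ^ (2 * ?N)) * indicator {x. 2 * norm y \<le> norm x} (x :: 'a)) \<partial>lborel)
          = ennreal (?w / (2 * norm y) ^ ?N)"
        using True by (intro nn_integral_tail_inverse_norm) auto
      also have "ennreal ((v y)\<^sup>2 * (4 ^ ?N * norm y ^ ?N)) * \<dots>
          = ennreal ((v y)\<^sup>2 * (4 ^ ?N * norm y ^ ?N) * (?w / (2 * norm y) ^ ?N))"
        by (rule ennreal_mult'[symmetric]) simp
      also have "(v y)\<^sup>2 * (4 ^ ?N * norm y ^ ?N) * (?w / (2 * norm y) ^ ?N) = 2 ^ ?N * ?w * (v y)\<^sup>2"
      proof -
        have "(4 :: real) ^ ?N = 2 ^ ?N * 2 ^ ?N"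
          by (simp only: flip: power_mult_distrib) simp
        moreover have "norm y \<noteq> 0" using True by linarith
        ultimately show ?thesis by (simp only: power_mult_distrib) simp
      qed
      also have "ennreal (2 ^ ?N * ?w * (v y)\<^sup>2) = ennreal (2 ^ ?N * ?w) * ennreal ((v y)\<^sup>2)"
        by (rule ennreal_mult') simp
      finally show ?thesis .
    qed simp
  qed
  also have "\<dots> = ennreal (2 ^ ?N * ?w) * sq_energy v"
    unfolding sq_energy_def by (rule nn_integral_cmult) measurable
  finally show ?thesis .
qed

end

section \<open>Inequalities between the energies\<close>

context
  fixes v :: "'a :: euclidean_space \<Rightarrow> real"
  assumes v[measurable]: "v \<in> borel_measurable borel"
begin

text \<open>As functions of two variables the kernels get their joint measurability once, and the
  pointwise bounds can then be integrated termwise. \<open>mass\<close> is the error at the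
  diagonal, \<open>logk\<close> the error in the lower bound for the weight.\<close>

private definition "near x y = ennreal ((v x - v y)\<^sup>2 / norm (x - y) ^ DIM('a)) * indicator {z. norm z < 1} (x - y)"
private definition "mass x y = ennreal ((v y)\<^sup>2) * (ennreal ((norm (x - y))\<^sup>2 / norm (x - y) ^ DIM('a)) *
      indicator {z. norm z < 1} (x - y))"
private definition "far x y = ennreal ((v x)\<^sup>2) *
    (ennreal (bracket x ^ DIM('a) / bracket y ^ DIM('a) / norm (x - y) ^ DIM('a)) * indicator {z. 1 \<le> norm z} (x - y))"
private definition "conf x y = ennreal (conf_diff DIM('a) v x y / norm (x - y) ^ DIM('a))"
private definition "logk x y = ennreal ((v y)\<^sup>2) * (ennreal (bracket y ^ DIM('a) / bracket x ^ DIM('a) / norm (x - y) ^ DIM('a)) *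
      indicator {y. 1 \<le> norm y \<and> 2 * norm y \<le> norm x} y)"

lemma
  measurable_near[measurable]: "case_prod near \<in> borel_measurable (lborel \<Otimes>\<^sub>M lborel)" and
  measurable_mass[measurable]: "case_prod mass \<in> borel_measurable (lborel \<Otimes>\<^sub>M lborel)" and
  measurable_far[measurable]: "case_prod far \<in> borel_measurable (lborel \<Otimes>\<^sub>M lborel)" and
  measurable_conf[measurable]: "case_prod conf \<in> borel_measurable (lborel \<Otimes>\<^sub>M lborel)" and
  measurable_logk[measurable]: "case_prod logk \<in> borel_measurable (lborel \<Otimes>\<^sub>M lborel)"
  unfolding near_def mass_def far_def conf_def logk_def by measurable

text \<open>Only one of the two groups is nonzero at a given (x, y), according to whether |x - y| is
  below 1. The transposed \<open>far y x\<close> carries the value of v at y.\<close>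

lemma conf_le_near_far:
  "conf x y \<le> (ennreal (2 * 2 ^ DIM('a)) * near x y + ennreal (2 * 8 ^ DIM('a)) * mass x y) + (2 * far x y + 2 * far y x)"
proof (cases "norm (x - y) < 1")
  case True
  let ?N = "DIM('a)" and ?d = "norm (x - y)"
  have "conf_diff ?N v x y / ?d ^ ?N \<le> (2 * 2 ^ ?N * (v x - v y)\<^sup>2 + 2 * 8 ^ ?N * ?d\<^sup>2 * (v y)\<^sup>2) / ?d ^ ?N"
    using True by (intro divide_right_mono conf_diff_le_near) auto
  also have "\<dots> = 2 * 2 ^ ?N * ((v x - v y)\<^sup>2 / ?d ^ ?N) + 2 * 8 ^ ?N * ((v y)\<^sup>2 * (?d\<^sup>2 / ?d ^ ?N))"
    by (simp add: add_divide_distrib mult_ac)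
  finally have "conf x y \<le> ennreal (2 * 2 ^ ?N * ((v x - v y)\<^sup>2 / ?d ^ ?N) + 2 * 8 ^ ?N * ((v y)\<^sup>2 * (?d\<^sup>2 / ?d ^ ?N)))"
    unfolding conf_def by (rule ennreal_leI)
  also have "\<dots> = ennreal (2 * 2 ^ ?N) * near x y + ennreal (2 * 8 ^ ?N) * mass x y"
  proof -
    have n: "near x y = ennreal ((v x - v y)\<^sup>2 / ?d ^ ?N)"
      using True by (simp add: near_def)
    have m: "mass x y = ennreal ((v y)\<^sup>2) * ennreal (?d\<^sup>2 / ?d ^ ?N)"
      using True by (simp add: mass_def)
    show ?thesis
      unfolding n m by (rule ennreal_lincomb) simp_all
  qed
  finally show ?thesis by (rule order_trans) simp
next
  case False
  let ?N = "DIM('a)" and ?d = "norm (x - y)" and ?A = "bracket x ^ DIM('a)" and ?B = "bracket y ^ DIM('a)"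
  have pos: "?A > 0" "?B > 0" by (simp_all add: bracket_pos)
  have "conf_diff ?N v x y / ?d ^ ?N \<le> (2 * (v x)\<^sup>2 * (?A / ?B) + 2 * (v y)\<^sup>2 * (?B / ?A)) / ?d ^ ?N"
    by (intro divide_right_mono conf_diff_le_far) auto
  also have "\<dots> = 2 * ((v x)\<^sup>2 * (?A / ?B / ?d ^ ?N)) + 2 * ((v y)\<^sup>2 * (?B / ?A / ?d ^ ?N))"
    by (simp add: add_divide_distrib)
  finally have "conf x y \<le> ennreal (2 * ((v x)\<^sup>2 * (?A / ?B / ?d ^ ?N)) + 2 * ((v y)\<^sup>2 * (?B / ?A / ?d ^ ?N)))"
    unfolding conf_def by (rule ennreal_leI)
  also have "\<dots> = ennreal (2 * ((v x)\<^sup>2 * (?A / ?B / ?d ^ ?N))) + ennreal (2 * ((v y)\<^sup>2 * (?B / ?A / ?d ^ ?N)))"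
    using pos by (intro ennreal_plus) simp_all
  also have "ennreal (2 * ((v x)\<^sup>2 * (?A / ?B / ?d ^ ?N))) = 2 * far x y"
  proof -
    have "ennreal (2 * ((v x)\<^sup>2 * (?A / ?B / ?d ^ ?N))) = ennreal 2 * (ennreal ((v x)\<^sup>2) * ennreal (?A / ?B / ?d ^ ?N))"
      using pos by (intro ennreal_mult3) simp_all
    then show ?thesis using False by (simp add: far_def)
  qed
  also have "ennreal (2 * ((v y)\<^sup>2 * (?B / ?A / ?d ^ ?N))) = 2 * far y x"
  proof -
    have "ennreal (2 * ((v y)\<^sup>2 * (?B / ?A / ?d ^ ?N))) = ennreal 2 * (ennreal ((v y)\<^sup>2) * ennreal (?B / ?A / ?d ^ ?N))"
      using pos by (intro ennreal_mult3) simp_all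
    then show ?thesis using False by (simp add: far_def norm_minus_commute)
  qed
  finally show ?thesis by (rule order_trans) simp
qed

text \<open>For |x - y| < 1 this is \<open>diff_square_le_near\<close> divided by |x - y|^N, with
  16^N = 2^N 8^N; elsewhere the left side is 0.\<close>

lemma near_le_conf:
  "near x y \<le> ennreal (2 * 2 ^ DIM('a)) * conf x y + ennreal (2 * 16 ^ DIM('a)) * mass x y"
proof (cases "norm (x - y) < 1")
  case True
  let ?N = "DIM('a)" and ?d = "norm (x - y)"
  have "(v x - v y)\<^sup>2 / ?d ^ ?N \<le> (2 ^ ?N * (2 * conf_diff ?N v x y + 2 * 8 ^ ?N * ?d\<^sup>2 * (v y)\<^sup>2)) / ?d ^ ?N"
    using True by (intro divide_right_mono diff_square_le_near) auto
  also have "\<dots> = 2 * 2 ^ ?N * (conf_diff ?N v x y / ?d ^ ?N) + 2 * (2 ^ ?N * 8 ^ ?N) * ((v y)\<^sup>2 * (?d\<^sup>2 / ?d ^ ?N))"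
    by (simp add: add_divide_distrib distrib_left mult_ac)
  also have "2 ^ ?N * 8 ^ ?N = (16 :: real) ^ ?N"
    by (simp only: flip: power_mult_distrib) simp
  finally have "ennreal ((v x - v y)\<^sup>2 / ?d ^ ?N)
      \<le> ennreal (2 * 2 ^ ?N * (conf_diff ?N v x y / ?d ^ ?N) + 2 * 16 ^ ?N * ((v y)\<^sup>2 * (?d\<^sup>2 / ?d ^ ?N)))"
    by (rule ennreal_leI)
  also have "\<dots> = ennreal (2 * 2 ^ ?N) * conf x y + ennreal (2 * 16 ^ ?N) * mass x y"
  proof -
    have m: "mass x y = ennreal ((v y)\<^sup>2) * ennreal (?d\<^sup>2 / ?d ^ ?N)"
      using True by (simp add: mass_def)
    show ?thesis
      unfolding m conf_def by (rule ennreal_lincomb) (simp_all add: conf_diff_nonneg)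
  qed
  finally show ?thesis using True by (simp add: near_def)
qed (simp add: near_def)

text \<open>On the region of the indicator, \<open>inverse_bracket_le_kernel\<close> inserts the
  kernel and \<open>square_le_conf_diff\<close> then trades v(x)^2 for the integrand of
  \<open>conf_energy\<close> and the error \<open>logk\<close>.\<close>

lemma inverse_bracket_le_conf:
  "ennreal ((v x)\<^sup>2) * (ennreal (1 / bracket y ^ DIM('a)) * indicator {y. 1 \<le> norm y \<and> 2 * norm y \<le> norm x} y)
    \<le> ennreal (2 ^ DIM('a)) * (2 * conf x y + 2 * logk x y)"
proof (cases "1 \<le> norm y \<and> 2 * norm y \<le> norm x")
  case True
  let ?N = "DIM('a)" and ?d = "norm (x - y)" and ?A = "bracket x ^ DIM('a)" and ?B = "bracket y ^ DIM('a)"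
  have pos: "?A > 0" "?B > 0" by (simp_all add: bracket_pos)
  have "(v x)\<^sup>2 * (1 / ?B) \<le> (v x)\<^sup>2 * (2 ^ ?N * (?A / ?B / ?d ^ ?N))"
    using True by (intro mult_left_mono inverse_bracket_le_kernel) auto
  also have "\<dots> = 2 ^ ?N * (((v x)\<^sup>2 * (?A / ?B)) / ?d ^ ?N)"
    by simp
  also have "\<dots> \<le> 2 ^ ?N * ((2 * conf_diff ?N v x y + 2 * (v y)\<^sup>2 * (?B / ?A)) / ?d ^ ?N)"
    by (intro mult_left_mono divide_right_mono square_le_conf_diff) auto
  also have "\<dots> = 2 ^ ?N * (2 * (conf_diff ?N v x y / ?d ^ ?N) + 2 * ((v y)\<^sup>2 * (?B / ?A / ?d ^ ?N)))"
    by (simp add: add_divide_distrib)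
  finally have "ennreal ((v x)\<^sup>2 * (1 / ?B)) \<le> ennreal (2 ^ ?N * (2 * (conf_diff ?N v x y / ?d ^ ?N) + 2 * ((v y)\<^sup>2 * (?B / ?A / ?d ^ ?N))))"
    by (rule ennreal_leI)
  also have "\<dots> = ennreal (2 ^ ?N) * (ennreal (2 * (conf_diff ?N v x y / ?d ^ ?N)) + ennreal (2 * ((v y)\<^sup>2 * (?B / ?A / ?d ^ ?N))))"
    using pos conf_diff_nonneg[of ?N v x y] by (subst ennreal_mult') (simp_all add: ennreal_plus)
  also have "ennreal (2 * (conf_diff ?N v x y / ?d ^ ?N)) = 2 * conf x y"
    by (subst ennreal_mult') (simp_all add: conf_def)
  also have "ennreal (2 * ((v y)\<^sup>2 * (?B / ?A / ?d ^ ?N))) = 2 * logk x y"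
  proof -
    have "ennreal (2 * ((v y)\<^sup>2 * (?B / ?A / ?d ^ ?N))) = ennreal 2 * (ennreal ((v y)\<^sup>2) * ennreal (?B / ?A / ?d ^ ?N))"
      using pos by (intro ennreal_mult3) simp_all
    then show ?thesis using True by (simp add: logk_def)
  qed
  also have "ennreal ((v x)\<^sup>2 * (1 / ?B)) = ennreal ((v x)\<^sup>2) * ennreal (1 / ?B)"
    by (rule ennreal_mult') simp
  finally show ?thesis using True by simp
qed simp

text \<open>By Tonelli the transposed far part integrates to the same value as the far part, whence
  4 = 2 + 2.\<close>

lemma conf_energy_le:
  "conf_energy v \<le> (ennreal (2 * 2 ^ DIM('a)) * near_energy v
      + ennreal (2 * 8 ^ DIM('a)) * (ennreal (DIM('a) * unit_ball_vol DIM('a) / 2) * sq_energy v))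
      + 4 * (ennreal (2 ^ DIM('a) * unit_ball_vol DIM('a) * (5 * DIM('a) + 2)) * log_energy v)"
proof -
  have swap: "(\<integral>\<^sup>+x. (\<integral>\<^sup>+y. far y x \<partial>lborel) \<partial>lborel) = (\<integral>\<^sup>+x. (\<integral>\<^sup>+y. far x y \<partial>lborel) \<partial>lborel)"
    by (rule lborel_pair.Fubini') measurable
  have "conf_energy v = (\<integral>\<^sup>+x. (\<integral>\<^sup>+y. conf x y \<partial>lborel) \<partial>lborel)"
    by (simp add: conf_energy_def conf_def)
  also have "\<dots> \<le> (\<integral>\<^sup>+x. (\<integral>\<^sup>+y. (ennreal (2 * 2 ^ DIM('a)) * near x y + ennreal (2 * 8 ^ DIM('a)) * mass x y)
      + (2 * far x y + 2 * far y x) \<partial>lborel) \<partial>lborel)"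
    by (intro nn_integral2_mono conf_le_near_far)
  also have "\<dots> = (ennreal (2 * 2 ^ DIM('a)) * (\<integral>\<^sup>+x. (\<integral>\<^sup>+y. near x y \<partial>lborel) \<partial>lborel)
      + ennreal (2 * 8 ^ DIM('a)) * (\<integral>\<^sup>+x. (\<integral>\<^sup>+y. mass x y \<partial>lborel) \<partial>lborel))
      + (2 * (\<integral>\<^sup>+x. (\<integral>\<^sup>+y. far x y \<partial>lborel) \<partial>lborel) + 2 * (\<integral>\<^sup>+x. (\<integral>\<^sup>+y. far y x \<partial>lborel) \<partial>lborel))"
    by (simp add: nn_integral2_add nn_integral2_cmult)
  also have "(\<integral>\<^sup>+x. (\<integral>\<^sup>+y. near x y \<partial>lborel) \<partial>lborel) = near_energy v"
    by (simp add: near_energy_def near_def)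
  also have "(\<integral>\<^sup>+x. (\<integral>\<^sup>+y. mass x y \<partial>lborel) \<partial>lborel) = ennreal (DIM('a) * unit_ball_vol DIM('a) / 2) * sq_energy v"
    unfolding mass_def by (rule nn_integral_near_mass) measurable
  also have "2 * (\<integral>\<^sup>+x. (\<integral>\<^sup>+y. far x y \<partial>lborel) \<partial>lborel) + 2 * (\<integral>\<^sup>+x. (\<integral>\<^sup>+y. far y x \<partial>lborel) \<partial>lborel)
      = 4 * (\<integral>\<^sup>+x. (\<integral>\<^sup>+y. far x y \<partial>lborel) \<partial>lborel)"
    unfolding swap by (simp flip: distrib_right)
  also have "(ennreal (2 * 2 ^ DIM('a)) * near_energy v
      + ennreal (2 * 8 ^ DIM('a)) * (ennreal (DIM('a) * unit_ball_vol DIM('a) / 2) * sq_energy v))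
      + 4 * (\<integral>\<^sup>+x. (\<integral>\<^sup>+y. far x y \<partial>lborel) \<partial>lborel)
    \<le> (ennreal (2 * 2 ^ DIM('a)) * near_energy v
      + ennreal (2 * 8 ^ DIM('a)) * (ennreal (DIM('a) * unit_ball_vol DIM('a) / 2) * sq_energy v))
      + 4 * (ennreal (2 ^ DIM('a) * unit_ball_vol DIM('a) * (5 * DIM('a) + 2)) * log_energy v)"
    unfolding far_def by (intro add_left_mono mult_left_mono nn_integral_far_mass_le v) simp
  finally show ?thesis .
qed

lemma near_energy_le:
  "near_energy v \<le> ennreal (2 * 2 ^ DIM('a)) * conf_energy v
      + ennreal (2 * 16 ^ DIM('a)) * (ennreal (DIM('a) * unit_ball_vol DIM('a) / 2) * sq_energy v)"
proof -
  have "near_energy v = (\<integral>\<^sup>+x. (\<integral>\<^sup>+y. near x y \<partial>lborel) \<partial>lborel)"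
    by (simp add: near_energy_def near_def)
  also have "\<dots> \<le> (\<integral>\<^sup>+x. (\<integral>\<^sup>+y. ennreal (2 * 2 ^ DIM('a)) * conf x y + ennreal (2 * 16 ^ DIM('a)) * mass x y \<partial>lborel) \<partial>lborel)"
    by (intro nn_integral2_mono near_le_conf)
  also have "\<dots> = ennreal (2 * 2 ^ DIM('a)) * (\<integral>\<^sup>+x. (\<integral>\<^sup>+y. conf x y \<partial>lborel) \<partial>lborel)
      + ennreal (2 * 16 ^ DIM('a)) * (\<integral>\<^sup>+x. (\<integral>\<^sup>+y. mass x y \<partial>lborel) \<partial>lborel)"
    by (simp add: nn_integral2_add nn_integral2_cmult)
  also have "(\<integral>\<^sup>+x. (\<integral>\<^sup>+y. mass x y \<partial>lborel) \<partial>lborel) = ennreal (DIM('a) * unit_ball_vol DIM('a) / 2) * sq_energy v"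
    unfolding mass_def by (rule nn_integral_near_mass) measurable
  also have "(\<integral>\<^sup>+x. (\<integral>\<^sup>+y. conf x y \<partial>lborel) \<partial>lborel) = conf_energy v"
    by (simp add: conf_energy_def conf_def)
  finally show ?thesis .
qed

text \<open>Bounding the weight at x by an integral over y turns the single integral into a double
  one, which can be compared pointwise with \<open>conf\<close>.\<close>

lemma log_energy_le:
  "log_energy v \<le> 3 * sq_energy v + ennreal (2 * 2 ^ DIM('a) / (DIM('a) * unit_ball_vol DIM('a))) *
     (ennreal (2 ^ DIM('a)) * (2 * conf_energy v + 2 * (ennreal (2 ^ DIM('a) * unit_ball_vol DIM('a)) * sq_energy v)))"
proof -
  let ?c = "ennreal (2 * 2 ^ DIM('a) / (DIM('a) * unit_ball_vol DIM('a)))"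
  define k where "k x y = ennreal (1 / bracket y ^ DIM('a)) * indicator {y. 1 \<le> norm y \<and> 2 * norm y \<le> norm x} y" for x y :: 'a
  have k[measurable]: "case_prod k \<in> borel_measurable (lborel \<Otimes>\<^sub>M lborel)"
    unfolding k_def by measurable
  have "log_energy v = (\<integral>\<^sup>+x. ennreal ((v x)\<^sup>2) * ennreal (ln (exp 1 + (norm x)\<^sup>2)) \<partial>lborel)"
    unfolding log_energy_def by (intro nn_integral_cong ennreal_mult') simp
  also have "\<dots> \<le> (\<integral>\<^sup>+x. ennreal ((v x)\<^sup>2) * (3 + ?c * (\<integral>\<^sup>+y. k x y \<partial>lborel)) \<partial>lborel)"
    unfolding k_def by (intro nn_integral_mono mult_left_mono ln_le_nn_integral_inverse_bracket) simp
  also have "\<dots> = (\<integral>\<^sup>+x. 3 * ennreal ((v x)\<^sup>2) + ?c * (\<integral>\<^sup>+y. ennreal ((v x)\<^sup>2) * k x y \<partial>lborel) \<partial>lborel)"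
  proof (rule nn_integral_cong)
    fix x
    have "(\<integral>\<^sup>+y. ennreal ((v x)\<^sup>2) * k x y \<partial>lborel) = ennreal ((v x)\<^sup>2) * (\<integral>\<^sup>+y. k x y \<partial>lborel)"
      by (rule nn_integral_cmult) (use measurable_Pair2[OF k] in simp)
    then show "ennreal ((v x)\<^sup>2) * (3 + ?c * (\<integral>\<^sup>+y. k x y \<partial>lborel))
        = 3 * ennreal ((v x)\<^sup>2) + ?c * (\<integral>\<^sup>+y. ennreal ((v x)\<^sup>2) * k x y \<partial>lborel)"
      by (simp only: distrib_left mult_ac)
  qed
  also have "\<dots> = 3 * sq_energy v + ?c * (\<integral>\<^sup>+x. (\<integral>\<^sup>+y. ennreal ((v x)\<^sup>2) * k x y \<partial>lborel) \<partial>lborel)"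
    unfolding sq_energy_def by (simp add: nn_integral_add nn_integral_cmult)
  also have "(\<integral>\<^sup>+x. (\<integral>\<^sup>+y. ennreal ((v x)\<^sup>2) * k x y \<partial>lborel) \<partial>lborel)
      \<le> (\<integral>\<^sup>+x. (\<integral>\<^sup>+y. ennreal (2 ^ DIM('a)) * (2 * conf x y + 2 * logk x y) \<partial>lborel) \<partial>lborel)"
    unfolding k_def by (intro nn_integral2_mono inverse_bracket_le_conf)
  also have "\<dots> = ennreal (2 ^ DIM('a)) * (2 * (\<integral>\<^sup>+x. (\<integral>\<^sup>+y. conf x y \<partial>lborel) \<partial>lborel)
      + 2 * (\<integral>\<^sup>+x. (\<integral>\<^sup>+y. logk x y \<partial>lborel) \<partial>lborel))"
    by (simp add: nn_integral2_add nn_integral2_cmult)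
  also have "(\<integral>\<^sup>+x. (\<integral>\<^sup>+y. conf x y \<partial>lborel) \<partial>lborel) = conf_energy v"
    by (simp add: conf_energy_def conf_def)
  also have "(\<integral>\<^sup>+x. (\<integral>\<^sup>+y. logk x y \<partial>lborel) \<partial>lborel) \<le> ennreal (2 ^ DIM('a) * unit_ball_vol DIM('a)) * sq_energy v"
    unfolding logk_def by (rule nn_integral_log_mass_le) measurable
  finally show ?thesis
    by (simp add: add_left_mono mult_left_mono)
qed

end

section \<open>Constants uniform in v\<close>

lemma weighted_sum_le:
  fixes X Y :: ennreal
  assumes "0 \<le> a" "0 \<le> b" "0 < c" "0 < d"
  shows "ennreal a * X + ennreal b * Y \<le> ennreal (max (a / c) (b / d)) * (ennreal c * X + ennreal d * Y)"
proof -
  have "ennreal a \<le> ennreal (max (a / c) (b / d)) * ennreal c"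
    using assms by (subst ennreal_mult'[symmetric]) (auto intro!: ennreal_leI simp: max_def field_simps)
  moreover have "ennreal b \<le> ennreal (max (a / c) (b / d)) * ennreal d"
    using assms by (subst ennreal_mult'[symmetric]) (auto intro!: ennreal_leI simp: max_def field_simps)
  ultimately show ?thesis
    unfolding distrib_left mult.assoc[symmetric] by (intro add_mono mult_right_mono) auto
qed

lemma conf_energy_bound:
  "\<exists>a\<ge>0. \<exists>b\<ge>0. \<forall>v \<in> borel_measurable (borel :: 'a :: euclidean_space measure).
     conf_energy v \<le> ennreal a * near_energy v + ennreal b * log_energy v"
\<comment> \<open>The witnesses remain schematic here and are read off from the final inequality,
  whose coefficients contain no v.\<close>
proof (intro exI conjI ballI)
  let ?N = "DIM('a)" and ?w = "unit_ball_vol (real DIM('a))"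
  have collect: "(a * X + ennreal b * (ennreal c * Y)) + ennreal d * (ennreal e * Y) = a * X + ennreal (b * c + d * e) * Y"
    if "0 \<le> b" "0 \<le> c" "0 \<le> d" "0 \<le> e" for a X Y :: ennreal and b c d e :: real
    using that by (simp add: ennreal_mult distrib_right mult.assoc add.assoc)
  fix v :: "'a \<Rightarrow> real" assume v: "v \<in> borel_measurable borel"
  have "conf_energy v \<le> (ennreal (2 * 2 ^ ?N) * near_energy v
      + ennreal (2 * 8 ^ ?N) * (ennreal (?N * ?w / 2) * sq_energy v))
      + 4 * (ennreal (2 ^ ?N * ?w * (5 * ?N + 2)) * log_energy v)"
    by (rule conf_energy_le[OF v])
  also have "\<dots> \<le> (ennreal (2 * 2 ^ ?N) * near_energy v
      + ennreal (2 * 8 ^ ?N) * (ennreal (?N * ?w / 2) * log_energy v))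
      + ennreal 4 * (ennreal (2 ^ ?N * ?w * (5 * ?N + 2)) * log_energy v)"
    using sq_energy_le_log_energy[of v] by (intro add_mono mult_left_mono) auto
  also have "\<dots> = ennreal (2 * 2 ^ ?N) * near_energy v +
      ennreal (2 * 8 ^ ?N * (?N * ?w / 2) + 4 * (2 ^ ?N * ?w * (5 * ?N + 2))) * log_energy v"
    by (rule collect) simp_all
  finally show "conf_energy v \<le> ennreal (2 * 2 ^ ?N) * near_energy v +
      ennreal (2 * 8 ^ ?N * (?N * ?w / 2) + 4 * (2 ^ ?N * ?w * (5 * ?N + 2))) * log_energy v" .
qed auto

lemma near_energy_bound:
  "\<exists>a\<ge>0. \<exists>b\<ge>0. \<forall>v \<in> borel_measurable (borel :: 'a :: euclidean_space measure).
     near_energy v \<le> ennreal a * conf_energy v + ennreal b * sq_energy v"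
proof (intro exI conjI ballI)
  let ?N = "DIM('a)" and ?w = "unit_ball_vol (real DIM('a))"
  fix v :: "'a \<Rightarrow> real" assume v: "v \<in> borel_measurable borel"
  have "near_energy v \<le> ennreal (2 * 2 ^ ?N) * conf_energy v
      + ennreal (2 * 16 ^ ?N) * (ennreal (?N * ?w / 2) * sq_energy v)"
    by (rule near_energy_le[OF v])
  also have "ennreal (2 * 16 ^ ?N) * (ennreal (?N * ?w / 2) * sq_energy v) = ennreal (2 * 16 ^ ?N * (?N * ?w / 2)) * sq_energy v"
    by (subst (2) ennreal_mult) (simp_all add: mult.assoc)
  finally show "near_energy v \<le> ennreal (2 * 2 ^ ?N) * conf_energy v + ennreal (2 * 16 ^ ?N * (?N * ?w / 2)) * sq_energy v" .
qed auto

lemma log_energy_bound: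
  "\<exists>a\<ge>0. \<exists>b\<ge>0. \<forall>v \<in> borel_measurable (borel :: 'a :: euclidean_space measure).
     log_energy v \<le> ennreal a * conf_energy v + ennreal b * sq_energy v"
proof (intro exI conjI ballI)
  let ?N = "DIM('a)" and ?w = "unit_ball_vol (real DIM('a))"
  let ?c = "2 * 2 ^ ?N / (?N * ?w)"
  fix v :: "'a \<Rightarrow> real" assume v: "v \<in> borel_measurable borel"
  have w: "0 \<le> ?w" "0 \<le> ?c" by simp_all
  have "log_energy v \<le> ennreal 3 * sq_energy v + ennreal ?c *
     (ennreal (2 ^ ?N) * (ennreal 2 * conf_energy v + ennreal 2 * (ennreal (2 ^ ?N * ?w) * sq_energy v)))"
    using log_energy_le[OF v] by simp
  also have "\<dots> = ennreal (?c * 2 ^ ?N * 2) * conf_energy v + ennreal (3 + ?c * 2 ^ ?N * 2 * (2 ^ ?N * ?w)) * sq_energy v"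
  proof -
    have 1: "ennreal (?c * 2 ^ ?N * 2) = ennreal ?c * ennreal (2 ^ ?N) * ennreal 2"
      using w by (simp only: ennreal_mult mult_nonneg_nonneg zero_le_power zero_le_numeral)
    have "ennreal (3 + ?c * 2 ^ ?N * 2 * (2 ^ ?N * ?w)) = ennreal 3 + ennreal (?c * 2 ^ ?N * 2 * (2 ^ ?N * ?w))"
      using w by (intro ennreal_plus) simp_all
    also have "ennreal (?c * 2 ^ ?N * 2 * (2 ^ ?N * ?w)) = ennreal (?c * 2 ^ ?N * 2) * ennreal (2 ^ ?N * ?w)"
      using w by (intro ennreal_mult) simp_all
    finally show ?thesis
      unfolding 1 by (simp only: distrib_left distrib_right mult.assoc add.commute add.left_commute)
  qed
  finally show "log_energy v \<le> ennreal (?c * 2 ^ ?N * 2) * conf_energy v + ennreal (3 + ?c * 2 ^ ?N * 2 * (2 ^ ?N * ?w)) * sq_energy v" .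
qed auto

text \<open>With c = c_N / 2 this is the squared norm of D(R^N) in terms of v alone;
  \<open>flat_energy\<close> is the squared logarithmic norm.\<close>

definition sphere_energy :: "real \<Rightarrow> real \<Rightarrow> ('a :: euclidean_space \<Rightarrow> real) \<Rightarrow> ennreal" where
  "sphere_energy c \<kappa> v = ennreal c * conf_energy v + ennreal \<kappa> * sq_energy v"

definition flat_energy :: "real \<Rightarrow> ('a :: euclidean_space \<Rightarrow> real) \<Rightarrow> ennreal" where
  "flat_energy c v = ennreal c * near_energy v + log_energy v"

lemma sphere_energy_le_flat_energy:
  assumes "c > 0" "\<kappa> > 0"
  shows "\<exists>C>0. \<forall>v \<in> borel_measurable (borel :: 'a :: euclidean_space measure).
    sphere_energy c \<kappa> v \<le> ennreal C * flat_energy c v"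
proof -
  obtain a b where ab: "a \<ge> 0" "b \<ge> 0" and
    conf: "\<And>v :: 'a \<Rightarrow> real. v \<in> borel_measurable borel \<Longrightarrow> conf_energy v \<le> ennreal a * near_energy v + ennreal b * log_energy v"
    using conf_energy_bound[where 'a = 'a] by blast
  \<comment> \<open>The quotients by c and by 1 match \<open>weighted_sum_le\<close>, since
    \<open>flat_energy\<close> has the coefficients c and 1.\<close>
  define C where "C = max (c * a / c) ((c * b + \<kappa>) / 1)"
  have "C > 0"
    using assms ab by (auto simp: C_def less_max_iff_disj intro!: add_nonneg_pos)
  moreover have "sphere_energy c \<kappa> v \<le> ennreal C * flat_energy c v" if "v \<in> borel_measurable borel" for v :: "'a \<Rightarrow> real"
  proof -
    have "sphere_energy c \<kappa> v \<le> ennreal c * (ennreal a * near_energy v + ennreal b * log_energy v) + ennreal \<kappa> * log_energy v"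
      unfolding sphere_energy_def by (intro add_mono mult_left_mono conf that sq_energy_le_log_energy) auto
    also have "\<dots> = ennreal (c * a) * near_energy v + ennreal (c * b + \<kappa>) * log_energy v"
      using assms ab by (simp add: ennreal_mult distrib_left distrib_right mult.assoc add.assoc)
    also have "\<dots> \<le> ennreal C * (ennreal c * near_energy v + ennreal 1 * log_energy v)"
      unfolding C_def using assms ab by (intro weighted_sum_le) auto
    finally show ?thesis by (simp add: flat_energy_def)
  qed
  ultimately show ?thesis by blast
qed

lemma flat_energy_le_sphere_energy:
  assumes "c > 0" "\<kappa> > 0"
  shows "\<exists>C>0. \<forall>v \<in> borel_measurable (borel :: 'a :: euclidean_space measure).
    flat_energy c v \<le> ennreal C * sphere_energy c \<kappa> v"
proof -
  obtain a b where ab: "a \<ge> 0" "b \<ge> 0" and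
    near: "\<And>v :: 'a \<Rightarrow> real. v \<in> borel_measurable borel \<Longrightarrow> near_energy v \<le> ennreal a * conf_energy v + ennreal b * sq_energy v"
    using near_energy_bound[where 'a = 'a] by blast
  obtain p q where pq: "p \<ge> 0" "q \<ge> 0" and
    log: "\<And>v :: 'a \<Rightarrow> real. v \<in> borel_measurable borel \<Longrightarrow> log_energy v \<le> ennreal p * conf_energy v + ennreal q * sq_energy v"
    using log_energy_bound[where 'a = 'a] by blast
  define C where "C = max ((c * a + p) / c) ((c * b + q) / \<kappa>)"
  have "C \<ge> 0"
    using assms ab pq by (auto simp: C_def le_max_iff_disj)
  have "flat_energy c v \<le> ennreal C * sphere_energy c \<kappa> v" if "v \<in> borel_measurable borel" for v :: "'a \<Rightarrow> real"
  proof -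
    have "flat_energy c v \<le> ennreal c * (ennreal a * conf_energy v + ennreal b * sq_energy v) +
        (ennreal p * conf_energy v + ennreal q * sq_energy v)"
      unfolding flat_energy_def by (intro add_mono mult_left_mono near log that) auto
    also have "\<dots> = ennreal (c * a + p) * conf_energy v + ennreal (c * b + q) * sq_energy v"
      using assms ab pq by (simp add: ennreal_mult distrib_left distrib_right mult.assoc add_ac)
    also have "\<dots> \<le> ennreal C * sphere_energy c \<kappa> v"
      unfolding C_def sphere_energy_def using assms ab pq by (intro weighted_sum_le) auto
    finally show ?thesis .
  qed
  \<comment> \<open>C may be 0 when all four coefficients are, so C + 1 serves as the positive
    constant.\<close>
  moreover have "ennreal C * X \<le> ennreal (C + 1) * X" for X
    using \<open>C \<ge> 0\<close> by (intro mult_right_mono ennreal_leI) auto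
  ultimately show ?thesis
    using \<open>C \<ge> 0\<close> by (intro exI[of _ "C + 1"]) (auto intro: order_trans)
qed

subsection \<open>Stereographic coordinates\<close>

lemma conf_factor_eq_bracket: "conf_factor x = 2 / (bracket x)\<^sup>2"
  by (simp add: conf_factor_def bracket_def)

lemma conf_factor_pos: "0 < conf_factor x"
  by (simp add: conf_factor_def add_pos_nonneg)

lemma one_plus_norm_sq_nonzero: "1 + (norm x)\<^sup>2 \<noteq> 0"
  using zero_le_power2[of "norm x"] by linarith

text \<open>Both coordinates become polynomial in x and the conformal factor p. The computations on
  the sphere then rest on the single relation p (1 + |x|^2) = 2.\<close>

lemma stereo_inv_eq: "stereo_inv x = (conf_factor x *\<^sub>R x, conf_factor x - 1)"
proof -
  have "1 - (norm x)\<^sup>2 = 2 - (1 + (norm x)\<^sup>2)"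
    by simp
  then have "(1 - (norm x)\<^sup>2) / (1 + (norm x)\<^sup>2) = conf_factor x - 1"
    using one_plus_norm_sq_nonzero[of x] by (simp only: conf_factor_def diff_divide_distrib) simp
  then show ?thesis by (simp add: stereo_inv_def conf_factor_def)
qed

lemma conf_factor_norm: "conf_factor x * (1 + (norm x)\<^sup>2) = 2"
  by (simp only: conf_factor_def times_divide_eq_left nonzero_mult_div_cancel_right one_plus_norm_sq_nonzero not_False_eq_True)

lemma conf_factor_has_derivative:
  "(conf_factor has_derivative (\<lambda>h. - ((conf_factor x)\<^sup>2 * (x \<bullet> h)))) (at x)"
proof -
  have nz: "1 + x \<bullet> x \<noteq> 0"
    using one_plus_norm_sq_nonzero[of x] by (simp add: power2_norm_eq_inner)
  have "((\<lambda>x. 2 / (1 + x \<bullet> x)) has_derivative (\<lambda>h. - ((2 / (1 + x \<bullet> x))\<^sup>2 * (x \<bullet> h)))) (at x)"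
    using nz by (auto intro!: derivative_eq_intros simp: fun_eq_iff power_divide power2_eq_square inner_commute)
  then show ?thesis
    by (simp add: conf_factor_def[abs_def] power2_norm_eq_inner)
qed

lemma stereo_inv_has_derivative:
  "(stereo_inv has_derivative (\<lambda>h. (conf_factor x *\<^sub>R h - ((conf_factor x)\<^sup>2 * (x \<bullet> h)) *\<^sub>R x,
     - ((conf_factor x)\<^sup>2 * (x \<bullet> h))))) (at x)"
proof -
  have "((\<lambda>x. (conf_factor x *\<^sub>R x, conf_factor x - 1)) has_derivative
     (\<lambda>h. (conf_factor x *\<^sub>R h - ((conf_factor x)\<^sup>2 * (x \<bullet> h)) *\<^sub>R x, - ((conf_factor x)\<^sup>2 * (x \<bullet> h))))) (at x)"
    by (auto intro!: derivative_eq_intros conf_factor_has_derivative)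
  then show ?thesis
    by (simp add: stereo_inv_eq[abs_def])
qed

text \<open>Stereographic projection is conformal: with p the conformal factor, the terms in (x
  \<bullet> h) (x \<bullet> k) have the coefficient -2 p^3 + p^4 (1 + |x|^2), which is 0 by
  \<open>conf_factor_norm\<close>.\<close>

lemma round_metric_eq: "round_metric x = (\<chi> i j. if i = j then (conf_factor x)\<^sup>2 else 0)"
proof -
  let ?p = "conf_factor x"
  have D: "frechet_derivative stereo_inv (at x) = (\<lambda>h. (?p *\<^sub>R h - (?p\<^sup>2 * (x \<bullet> h)) *\<^sub>R x, - (?p\<^sup>2 * (x \<bullet> h))))"
    by (rule frechet_derivative_at[OF stereo_inv_has_derivative, symmetric])
  have "(?p *\<^sub>R h - (?p\<^sup>2 * (x \<bullet> h)) *\<^sub>R x) \<bullet> (?p *\<^sub>R k - (?p\<^sup>2 * (x \<bullet> k)) *\<^sub>R x) + (?p\<^sup>2 * (x \<bullet> h)) * (?p\<^sup>2 * (x \<bullet> k))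
      = ?p\<^sup>2 * (h \<bullet> k)" for h k
  proof -
    have "(?p *\<^sub>R h - (?p\<^sup>2 * (x \<bullet> h)) *\<^sub>R x) \<bullet> (?p *\<^sub>R k - (?p\<^sup>2 * (x \<bullet> k)) *\<^sub>R x) + (?p\<^sup>2 * (x \<bullet> h)) * (?p\<^sup>2 * (x \<bullet> k))
      = ?p\<^sup>2 * (h \<bullet> k) - 2 * ?p ^ 3 * (x \<bullet> h) * (x \<bullet> k) + ?p ^ 3 * (x \<bullet> h) * (x \<bullet> k) * (?p * (1 + (norm x)\<^sup>2))"
      unfolding power2_norm_eq_inner
      by (simp add: inner_diff_left inner_diff_right algebra_simps power2_eq_square power3_eq_cube inner_commute)
    then show ?thesis by (simp add: conf_factor_norm)
  qed
  then show ?thesis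
    by (simp add: round_metric_def D inner_axis_axis vec_eq_iff)
qed

lemma sqrt_det_round_metric: "sqrt (det (round_metric (x :: real ^ 'n))) = conf_factor x ^ CARD('n)"
proof -
  have "det (round_metric x) = (\<Prod>i\<in>(UNIV :: 'n set). (conf_factor x)\<^sup>2)"
    by (subst det_diagonal) (auto simp: round_metric_eq)
  also have "\<dots> = (conf_factor x ^ CARD('n))\<^sup>2"
    by (simp add: power_mult[symmetric] mult.commute)
  finally show ?thesis
    using conf_factor_pos[of x] by simp
qed

lemma norm_stereo_inv: "norm (stereo_inv x) = 1"
proof -
  have "(norm (stereo_inv x))\<^sup>2 = (conf_factor x)\<^sup>2 * (norm x)\<^sup>2 + (conf_factor x - 1)\<^sup>2"
    by (simp add: stereo_inv_eq norm_Pair power_mult_distrib)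
  also have "\<dots> = conf_factor x * (conf_factor x * (1 + (norm x)\<^sup>2)) - 2 * conf_factor x + 1"
    by (simp add: power2_eq_square algebra_simps)
  also have "\<dots> = 1"
    by (simp add: conf_factor_norm)
  finally show ?thesis
    using norm_ge_zero[of "stereo_inv x"] by (metis abs_norm_cancel power2_eq_1_iff abs_1 abs_minus_cancel)
qed

lemma norm_stereo_inv_diff:
  "norm (stereo_inv x - stereo_inv y) = 2 * norm (x - y) / (bracket x * bracket y)"
proof -
  let ?p = "conf_factor x" and ?q = "conf_factor y"
  have "(norm (stereo_inv x - stereo_inv y))\<^sup>2 = (norm (?p *\<^sub>R x - ?q *\<^sub>R y))\<^sup>2 + (?p - ?q)\<^sup>2"
    by (simp add: stereo_inv_eq norm_Pair)
  also have "\<dots> = ?p * (?p * (1 + (norm x)\<^sup>2)) + ?q * (?q * (1 + (norm y)\<^sup>2)) - 2 * ?p * ?q * (1 + x \<bullet> y)"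
    unfolding power2_norm_eq_inner
    by (simp add: inner_diff_left inner_diff_right power2_eq_square algebra_simps inner_commute)
  \<comment> \<open>Both lines contain 2 p + 2 q. Each 2 is re-expanded with the relation at the
    other point, so that p q becomes a common factor.\<close>
  also have "\<dots> = ?p * (?q * (1 + (norm y)\<^sup>2)) + ?q * (?p * (1 + (norm x)\<^sup>2)) - 2 * ?p * ?q * (1 + x \<bullet> y)"
    by (simp add: conf_factor_norm)
  also have "\<dots> = ?p * ?q * (norm (x - y))\<^sup>2"
    unfolding power2_norm_eq_inner
    by (simp add: inner_diff_left inner_diff_right algebra_simps inner_commute)
  also have "\<dots> = (2 * norm (x - y) / (bracket x * bracket y))\<^sup>2"
    by (simp add: conf_factor_eq_bracket power_mult_distrib power_divide)
  finally show ?thesis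
    by (rule power2_eq_imp_eq) (use bracket_pos[of x] bracket_pos[of y] in auto)
qed

lemma measurable_stereo_inv[measurable]:
  "(stereo_inv :: real ^ 'n \<Rightarrow> _) \<in> borel \<rightarrow>\<^sub>M restrict_space borel (sphere 0 1)"
proof (rule measurable_restrict_space2)
  have "continuous_on UNIV (stereo_inv :: real ^ 'n \<Rightarrow> _)"
    by (rule has_derivative_continuous_on) (rule stereo_inv_has_derivative)
  then show "(stereo_inv :: real ^ 'n \<Rightarrow> _) \<in> borel_measurable borel"
    by (rule borel_measurable_continuous_onI)
qed (simp add: norm_stereo_inv)

lemma measurable_conf_factor[measurable]: "(conf_factor :: real ^ 'n \<Rightarrow> real) \<in> borel_measurable borel"
  unfolding conf_factor_def by measurable

lemma sets_sphere_vol: "sets (sphere_vol :: ((real ^ 'n) \<times> real) measure) = sets (restrict_space borel (sphere 0 1))"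
  by (simp add: sphere_vol_def)

lemma borel_measurable_sphere_vol:
  "borel_measurable (sphere_vol :: ((real ^ 'n) \<times> real) measure) = borel_measurable (restrict_space borel (sphere 0 1))"
  by (rule measurable_cong_sets) (simp_all add: sets_sphere_vol)

lemma nn_integral_sphere_vol:
  assumes [measurable]: "f \<in> borel_measurable (restrict_space borel (sphere (0 :: (real ^ 'n) \<times> real) 1))"
  shows "(\<integral>\<^sup>+z. f z \<partial>sphere_vol) = (\<integral>\<^sup>+x. ennreal (conf_factor x ^ CARD('n)) * f (stereo_inv x) \<partial>lborel)"
proof -
  have "(\<integral>\<^sup>+z. f z \<partial>sphere_vol) = (\<integral>\<^sup>+x. f (stereo_inv x) \<partial>density lborel (\<lambda>x. ennreal (conf_factor x ^ CARD('n))))"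
    unfolding sphere_vol_def sqrt_det_round_metric by (rule nn_integral_distr) measurable
  also have "\<dots> = (\<integral>\<^sup>+x. ennreal (conf_factor x ^ CARD('n)) * f (stereo_inv x) \<partial>lborel)"
    by (rule nn_integral_density) measurable
  finally show ?thesis .
qed

text \<open>The square root of the conformal factor is sqrt 2 / R(x). This replaces the real
  exponent N/2 by the natural powers used in \<open>conf_diff\<close>.\<close>

lemma conf_factor_powr: "conf_factor x powr (real n / 2) = sqrt 2 ^ n / bracket x ^ n"
proof -
  have "conf_factor x powr (real n / 2) = (conf_factor x powr (1 / 2)) powr real n"
    by (simp add: powr_powr)
  also have "\<dots> = (sqrt 2 / bracket x) ^ n"
    using conf_factor_pos[of x] bracket_pos[of x]
    by (simp add: powr_half_sqrt powr_realpow conf_factor_eq_bracket real_sqrt_divide)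
  finally show ?thesis by (simp add: power_divide)
qed

lemma iota_eq: "iota u x = sqrt 2 ^ CARD('n) / bracket x ^ CARD('n) * u (stereo_inv (x :: real ^ 'n))"
  by (simp add: iota_def conf_factor_powr)

lemma measurable_iota:
  assumes [measurable]: "u \<in> borel_measurable (sphere_vol :: ((real ^ 'n) \<times> real) measure)"
  shows "iota u \<in> borel_measurable borel"
proof -
  have [measurable]: "u \<in> borel_measurable (restrict_space borel (sphere 0 1))"
    using assms unfolding borel_measurable_sphere_vol .
  show ?thesis
    unfolding iota_eq[abs_def] by measurable
qed

text \<open>The two densities give 4^N / (A B)^2 and the chord identity gives A B / (2^N |x - y|^N).
  The remaining 2^N / (A B) is exactly what \<open>iota\<close> absorbs, as \<open>iota u\<close>
  times the bracket power is sqrt 2 ^ N times u. On the diagonal both sides are 0.\<close>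

lemma conformal_integrand:
  fixes x y :: "real ^ 'n"
  shows "conf_factor x ^ CARD('n) * (conf_factor y ^ CARD('n) *
      ((u (stereo_inv x) - u (stereo_inv y))\<^sup>2 / norm (stereo_inv x - stereo_inv y) ^ CARD('n)))
    = conf_diff CARD('n) (iota u) x y / norm (x - y) ^ CARD('n)"
proof (cases "x = y")
  case False
  let ?N = "CARD('n)"
  define A B d p q where "A = bracket x ^ ?N" and "B = bracket y ^ ?N" and "d = norm (x - y) ^ ?N"
    and "p = u (stereo_inv x)" and "q = u (stereo_inv y)"
  have pos: "A > 0" "B > 0" "d > 0"
    using False by (simp_all add: A_def B_def d_def bracket_pos)
  have cx: "conf_factor x ^ ?N = 2 ^ ?N / A\<^sup>2" and cy: "conf_factor y ^ ?N = 2 ^ ?N / B\<^sup>2"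
    by (simp_all add: conf_factor_eq_bracket A_def B_def power_divide power_mult[symmetric] mult.commute)
  have n: "norm (stereo_inv x - stereo_inv y) ^ ?N = 2 ^ ?N * d / (A * B)"
    by (simp add: norm_stereo_inv_diff A_def B_def d_def power_divide power_mult_distrib)
  have s: "(sqrt 2 ^ ?N)\<^sup>2 = (2 :: real) ^ ?N"
    by (simp add: power_mult[symmetric] mult.commute[of ?N]) (simp add: power_mult)
  have i: "iota u x * A = sqrt 2 ^ ?N * p" "iota u y * B = sqrt 2 ^ ?N * q"
    using bracket_pos[of x] bracket_pos[of y] by (simp_all add: iota_eq A_def B_def p_def q_def)
  have "conf_diff ?N (iota u) x y = (sqrt 2 ^ ?N * p - sqrt 2 ^ ?N * q)\<^sup>2 / (A * B)"
    unfolding conf_diff_def A_def[symmetric] B_def[symmetric] i ..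
  also have "\<dots> = 2 ^ ?N * (p - q)\<^sup>2 / (A * B)"
    by (simp add: right_diff_distrib[symmetric] power_mult_distrib s)
  finally have c: "conf_diff ?N (iota u) x y = 2 ^ ?N * (p - q)\<^sup>2 / (A * B)" .
  show ?thesis
    unfolding c cx cy n p_def[symmetric] q_def[symmetric] d_def[symmetric]
    using pos by (simp add: field_simps power2_eq_square)
qed (simp add: conf_diff_def)

lemma square_integrand:
  fixes x :: "real ^ 'n"
  shows "conf_factor x ^ CARD('n) * (u (stereo_inv x))\<^sup>2 = (iota u x)\<^sup>2"
proof -
  have s: "(sqrt 2 ^ CARD('n))\<^sup>2 = (2 :: real) ^ CARD('n)"
    by (simp add: power_mult[symmetric] mult.commute[of "CARD('n)"]) (simp add: power_mult)
  show ?thesis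
    by (simp add: iota_eq conf_factor_eq_bracket power_mult_distrib power_divide s)
      (simp add: power_mult[symmetric] mult.commute)
qed

lemma nn_integral_sphere_square:
  assumes "u \<in> borel_measurable (sphere_vol :: ((real ^ 'n) \<times> real) measure)"
  shows "(\<integral>\<^sup>+z. ennreal ((u z)\<^sup>2) \<partial>sphere_vol) = sq_energy (iota u)"
proof -
  have [measurable]: "u \<in> borel_measurable (restrict_space borel (sphere 0 1))"
    using assms unfolding borel_measurable_sphere_vol .
  show ?thesis
    unfolding sq_energy_def
    by (subst nn_integral_sphere_vol)
      (auto intro!: nn_integral_cong simp: square_integrand[symmetric] ennreal_mult conf_factor_pos less_imp_le)
qed

lemma nn_integral_sphere_double:
  assumes "u \<in> borel_measurable (sphere_vol :: ((real ^ 'n) \<times> real) measure)"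
  shows "(\<integral>\<^sup>+z. (\<integral>\<^sup>+\<zeta>. ennreal ((u z - u \<zeta>)\<^sup>2 / norm (z - \<zeta>) ^ CARD('n)) \<partial>sphere_vol) \<partial>sphere_vol) = conf_energy (iota u)"
proof -
  let ?S = "restrict_space borel (sphere (0 :: (real ^ 'n) \<times> real) 1)"
  have u[measurable]: "u \<in> borel_measurable ?S"
    using assms unfolding borel_measurable_sphere_vol .
  have id[measurable]: "(\<lambda>z. z) \<in> ?S \<rightarrow>\<^sub>M borel"
    by (rule measurable_restrict_space1) simp
  have st[measurable]: "(stereo_inv :: real ^ 'n \<Rightarrow> _) \<in> borel \<rightarrow>\<^sub>M borel"
    using measurable_compose[OF measurable_stereo_inv id] by simp
  have inner: "(\<integral>\<^sup>+\<zeta>. ennreal ((u z - u \<zeta>)\<^sup>2 / norm (z - \<zeta>) ^ CARD('n)) \<partial>sphere_vol)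
      = (\<integral>\<^sup>+y. ennreal (conf_factor y ^ CARD('n)) *
          ennreal ((u z - u (stereo_inv y))\<^sup>2 / norm (z - stereo_inv y) ^ CARD('n)) \<partial>lborel)" for z
    by (rule nn_integral_sphere_vol) measurable
  \<comment> \<open>To transfer the outer integral, the inner one must be measurable in z on the
    sphere; this follows from joint measurability.\<close>
  have "(\<lambda>(z, y). ennreal (conf_factor y ^ CARD('n)) *
      ennreal ((u z - u (stereo_inv y))\<^sup>2 / norm (z - stereo_inv y) ^ CARD('n))) \<in> borel_measurable (?S \<Otimes>\<^sub>M lborel)"
    by measurable
  then have outer: "(\<lambda>z. \<integral>\<^sup>+y. ennreal (conf_factor y ^ CARD('n)) *
      ennreal ((u z - u (stereo_inv y))\<^sup>2 / norm (z - stereo_inv y) ^ CARD('n)) \<partial>lborel) \<in> borel_measurable ?S"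
    by (rule lborel.borel_measurable_nn_integral)
  have "(\<integral>\<^sup>+z. (\<integral>\<^sup>+\<zeta>. ennreal ((u z - u \<zeta>)\<^sup>2 / norm (z - \<zeta>) ^ CARD('n)) \<partial>sphere_vol) \<partial>sphere_vol)
    = (\<integral>\<^sup>+x. ennreal (conf_factor x ^ CARD('n)) * (\<integral>\<^sup>+y. ennreal (conf_factor y ^ CARD('n)) *
      ennreal ((u (stereo_inv x) - u (stereo_inv y))\<^sup>2 / norm (stereo_inv x - stereo_inv y) ^ CARD('n)) \<partial>lborel) \<partial>lborel)"
    unfolding inner by (rule nn_integral_sphere_vol[OF outer])
  also have "\<dots> = (\<integral>\<^sup>+x. (\<integral>\<^sup>+y. ennreal (conf_factor x ^ CARD('n)) * (ennreal (conf_factor y ^ CARD('n)) *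
      ennreal ((u (stereo_inv x) - u (stereo_inv y))\<^sup>2 / norm (stereo_inv x - stereo_inv y) ^ CARD('n))) \<partial>lborel) \<partial>lborel)"
    by (intro nn_integral_cong nn_integral_cmult[symmetric]) measurable
  also have "\<dots> = conf_energy (iota u)"
    unfolding conf_energy_def
    unfolding conformal_integrand[symmetric] DIM_cart DIM_real mult_1_right
    by (intro nn_integral_cong ennreal_mult3[symmetric]) (simp_all add: conf_factor_pos less_imp_le)
  finally show ?thesis .
qed

lemma H_energy_eq:
  assumes "u \<in> borel_measurable (sphere_vol :: ((real ^ 'n) \<times> real) measure)"
  shows "H_energy \<kappa> u = ennreal (c_const CARD('n) / 2) * conf_energy (iota u) + ennreal \<kappa> * sq_energy (iota u)"
  unfolding H_energy_def nn_integral_sphere_double[OF assms] nn_integral_sphere_square[OF assms] ..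

text \<open>\<open>st\<close> is the stereographic projection itself, since 1 + \<open>snd z\<close>
  is the conformal factor at the image point. At the pole, division by zero makes \<open>st\<close>
  equal to 0; this choice is invisible to \<open>iota\<close>, because \<open>stereo_inv\<close>
  never reaches the pole.\<close>

lemma iota_surj:
  assumes [measurable]: "v \<in> borel_measurable (borel :: (real ^ 'n) measure)"
  shows "\<exists>u \<in> borel_measurable sphere_vol. iota u = v"
proof (intro bexI)
  let ?S = "restrict_space borel (sphere (0 :: (real ^ 'n) \<times> real) 1)"
  define st where "st z = (1 / (1 + snd z)) *\<^sub>R fst z" for z :: "(real ^ 'n) \<times> real"
  have st: "st (stereo_inv x) = x" for x
    using conf_factor_pos[of x] by (simp add: st_def stereo_inv_eq)
  let ?u = "\<lambda>z. conf_factor (st z) powr (- (real CARD('n) / 2)) * v (st z)"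
  have [measurable]: "fst \<in> borel_measurable (borel :: ((real ^ 'n) \<times> real) measure)"
    "snd \<in> borel_measurable (borel :: ((real ^ 'n) \<times> real) measure)"
    by (intro borel_measurable_continuous_onI continuous_intros)+
  have [measurable]: "st \<in> borel_measurable borel"
    unfolding st_def by measurable
  have "?u \<in> borel_measurable borel"
    by measurable
  then show "?u \<in> borel_measurable sphere_vol"
    unfolding borel_measurable_sphere_vol by (rule measurable_restrict_space1)
  show "iota ?u = v"
  proof
    fix x
    show "iota ?u x = v x"
      using conf_factor_pos[of x] by (simp add: iota_def st mult.assoc[symmetric] powr_add[symmetric])
  qed
qed

subsection \<open>The function spaces\<close>

lemma c_const_pos: "0 < c_const CARD('n :: finite)"
  by (simp add: c_const_def Gamma_real_pos)

lemma Dlog_energy_eq: "Dlog_energy v = flat_energy (c_const CARD('n) / 2) (v :: real ^ 'n \<Rightarrow> real)"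
proof -
  have "indicator (ball x 1) y = (indicator {z. norm z < 1} (x - y) :: ennreal)" for x y :: "real ^ 'n"
    by (simp add: dist_norm indicator_def)
  then show ?thesis
    by (simp add: Dlog_energy_def flat_energy_def near_energy_def log_energy_def)
qed

text \<open>Square integrability comes from the logarithmic term, whose weight is at least
  1.\<close>

lemma Dlog_space_eq:
  "Dlog_space = {v \<in> borel_measurable borel. flat_energy (c_const CARD('n) / 2) (v :: real ^ 'n \<Rightarrow> real) < \<infinity>}"
proof -
  have "integrable lborel (\<lambda>x. (v x)\<^sup>2)"
    if "v \<in> borel_measurable borel" "flat_energy (c_const CARD('n) / 2) v < \<infinity>" for v :: "real ^ 'n \<Rightarrow> real"
  proof (rule integrableI_nonneg)
    have "sq_energy v \<le> flat_energy (c_const CARD('n) / 2) v"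
      using sq_energy_le_log_energy[of v] by (simp add: flat_energy_def add_increasing)
    then show "(\<integral>\<^sup>+x. ennreal ((v x)\<^sup>2) \<partial>lborel) < \<infinity>"
      using that by (simp add: sq_energy_def)
  qed (use that in measurable)
  then show ?thesis
    by (auto simp: Dlog_space_def Dlog_energy_eq)
qed

lemma H_space_iff:
  fixes u :: "(real ^ 'n) \<times> real \<Rightarrow> real"
  assumes "\<kappa> > 0"
  shows "u \<in> H_space \<kappa> \<longleftrightarrow>
    u \<in> borel_measurable sphere_vol \<and> sphere_energy (c_const CARD('n) / 2) \<kappa> (iota u) < \<infinity>"
proof -
  have "integrable sphere_vol (\<lambda>z. (u z)\<^sup>2)"
    if u: "u \<in> borel_measurable sphere_vol" and fin: "sphere_energy (c_const CARD('n) / 2) \<kappa> (iota u) < \<infinity>"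
  proof (rule integrableI_nonneg)
    have "ennreal \<kappa> * sq_energy (iota u) < \<infinity>"
      using fin by (simp add: sphere_energy_def)
    then have "sq_energy (iota u) < \<infinity>"
      using assms by (auto simp: ennreal_mult_less_top)
    then show "(\<integral>\<^sup>+z. ennreal ((u z)\<^sup>2) \<partial>sphere_vol) < \<infinity>"
      by (simp add: nn_integral_sphere_square[OF u])
  qed (use u in measurable)
  then show ?thesis
    by (auto simp: H_space_def H_energy_eq sphere_energy_def)
qed

lemma D_space_eq:
  assumes "\<kappa> > 0"
  shows "D_space \<kappa> = {v \<in> borel_measurable borel. sphere_energy (c_const CARD('n) / 2) \<kappa> (v :: real ^ 'n \<Rightarrow> real) < \<infinity>}"
proof (intro equalityI subsetI)
  fix v :: "real ^ 'n \<Rightarrow> real"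
  assume "v \<in> {v \<in> borel_measurable borel. sphere_energy (c_const CARD('n) / 2) \<kappa> v < \<infinity>}"
  then obtain u where "u \<in> borel_measurable sphere_vol" "iota u = v" "sphere_energy (c_const CARD('n) / 2) \<kappa> v < \<infinity>"
    using iota_surj[of v] by blast
  then show "v \<in> D_space \<kappa>"
    using H_space_iff[OF assms, of u] by (auto simp: D_space_def)
qed (auto simp: D_space_def H_space_iff[OF assms] measurable_iota)

text \<open>The definite description is well defined because the energy of u depends on u only
  through \<open>iota u\<close>, so every preimage of v gives the same number.\<close>

lemma D_norm_eq:
  fixes v :: "real ^ 'n \<Rightarrow> real"
  assumes "v \<in> D_space \<kappa>"
  shows "D_norm \<kappa> v = sqrt (enn2real (sphere_energy (c_const CARD('n) / 2) \<kappa> v))"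
proof -
  have *: "H_norm \<kappa> u = sqrt (enn2real (sphere_energy (c_const CARD('n) / 2) \<kappa> (iota u)))"
    if "u \<in> H_space \<kappa>" for u :: "(real ^ 'n) \<times> real \<Rightarrow> real"
    using that by (simp add: H_norm_def H_energy_eq sphere_energy_def H_space_def)
  show ?thesis
    unfolding D_norm_def
  proof (rule the_equality)
    show "\<exists>u\<in>H_space \<kappa>. v = iota u \<and> sqrt (enn2real (sphere_energy (c_const CARD('n) / 2) \<kappa> v)) = H_norm \<kappa> u"
      using assms * by (auto simp: D_space_def)
  qed (auto simp: *)
qed

lemma sqrt_enn2real_le:
  assumes "X \<le> ennreal C * Y" "Y < \<infinity>" "C > 0"
  shows "sqrt (enn2real X) \<le> sqrt C * sqrt (enn2real Y)"
proof -
  \<comment> \<open>\<open>enn2real\<close> sends infinity to 0, so it is monotone only where the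
    larger value is finite.\<close>
  have "enn2real X \<le> enn2real (ennreal C * Y)"
    using assms by (intro enn2real_mono) (auto simp: ennreal_mult_less_top)
  also have "\<dots> = C * enn2real Y"
    using assms by (simp add: enn2real_mult)
  finally show ?thesis
    by (simp add: real_sqrt_mult[symmetric])
qed

lemma D_space_eq_Dlog_space:
  assumes "\<kappa> > 0"
  shows "D_space \<kappa> = (Dlog_space :: (real ^ 'n \<Rightarrow> real) set)"
    and "\<exists>C. \<forall>v \<in> (Dlog_space :: (real ^ 'n \<Rightarrow> real) set). D_norm \<kappa> v \<le> C * Dlog_norm v"
    and "\<exists>C. \<forall>v \<in> (Dlog_space :: (real ^ 'n \<Rightarrow> real) set). Dlog_norm v \<le> C * D_norm \<kappa> v"
proof -
  let ?c = "c_const CARD('n) / 2"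
  have c: "?c > 0" using c_const_pos[where 'n = 'n] by simp
  obtain C1 where C1: "C1 > 0" and le1:
    "\<And>v :: real ^ 'n \<Rightarrow> real. v \<in> borel_measurable borel \<Longrightarrow> sphere_energy ?c \<kappa> v \<le> ennreal C1 * flat_energy ?c v"
    using sphere_energy_le_flat_energy[OF c assms, where 'a = "real ^ 'n"] by blast
  obtain C2 where C2: "C2 > 0" and le2:
    "\<And>v :: real ^ 'n \<Rightarrow> real. v \<in> borel_measurable borel \<Longrightarrow> flat_energy ?c v \<le> ennreal C2 * sphere_energy ?c \<kappa> v"
    using flat_energy_le_sphere_energy[OF c assms, where 'a = "real ^ 'n"] by blast
  have fin: "sphere_energy ?c \<kappa> v < \<infinity> \<longleftrightarrow> flat_energy ?c v < \<infinity>"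
    if v: "v \<in> borel_measurable borel" for v :: "real ^ 'n \<Rightarrow> real"
  proof
    assume "sphere_energy ?c \<kappa> v < \<infinity>"
    then have "ennreal C2 * sphere_energy ?c \<kappa> v < \<infinity>" by (simp add: ennreal_mult_less_top)
    then show "flat_energy ?c v < \<infinity>" by (rule le_less_trans[OF le2[OF v]])
  next
    assume "flat_energy ?c v < \<infinity>"
    then have "ennreal C1 * flat_energy ?c v < \<infinity>" by (simp add: ennreal_mult_less_top)
    then show "sphere_energy ?c \<kappa> v < \<infinity>" by (rule le_less_trans[OF le1[OF v]])
  qed
  show eq: "D_space \<kappa> = (Dlog_space :: (real ^ 'n \<Rightarrow> real) set)"
    using fin by (auto simp: D_space_eq[OF assms] Dlog_space_eq)
  have norms: "D_norm \<kappa> v = sqrt (enn2real (sphere_energy ?c \<kappa> v))" "Dlog_norm v = sqrt (enn2real (flat_energy ?c v))"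
    "v \<in> borel_measurable borel" "flat_energy ?c v < \<infinity>" "sphere_energy ?c \<kappa> v < \<infinity>"
    if "v \<in> Dlog_space" for v :: "real ^ 'n \<Rightarrow> real"
    using that D_norm_eq[of v \<kappa>] fin[of v] unfolding eq by (auto simp: Dlog_norm_def Dlog_energy_eq Dlog_space_eq)
  show "\<exists>C. \<forall>v \<in> (Dlog_space :: (real ^ 'n \<Rightarrow> real) set). D_norm \<kappa> v \<le> C * Dlog_norm v"
    using sqrt_enn2real_le[OF le1 _ C1] by (intro exI[of _ "sqrt C1"] ballI) (simp only: norms)
  show "\<exists>C. \<forall>v \<in> (Dlog_space :: (real ^ 'n \<Rightarrow> real) set). Dlog_norm v \<le> C * D_norm \<kappa> v"
    using sqrt_enn2real_le[OF le2 _ C2] by (intro exI[of _ "sqrt C2"] ballI) (simp only: norms)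
qed

section \<open>Invariance under null sets and closure under linear combinations\<close>

lemma flat_energy_cong_AE:
  fixes v w :: "'a :: euclidean_space \<Rightarrow> real"
  assumes "AE x in lborel. v x = w x"
  shows "flat_energy c v = flat_energy c w"
proof -
  have "near_energy v = near_energy w"
    unfolding near_energy_def
  \<comment> \<open>The null set is discarded twice: first in x, and then, for a fixed good x, in
    y.\<close>
  proof (rule nn_integral_cong_AE, use assms in eventually_elim)
    case x: (elim x)
    show ?case
      by (rule nn_integral_cong_AE, use assms in eventually_elim) (simp add: x)
  qed
  moreover have "log_energy v = log_energy w"
    unfolding log_energy_def by (rule nn_integral_cong_AE, use assms in eventually_elim) simp
  ultimately show ?thesis by (simp add: flat_energy_def)
qed

lemma square_lincomb_le: "((a :: real) * s + b * t)\<^sup>2 \<le> 2 * a\<^sup>2 * s\<^sup>2 + 2 * b\<^sup>2 * t\<^sup>2"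
  using square_add_le[of "a * s" "b * t"] by (simp add: power_mult_distrib)

text \<open>Both the increments and the values of the combination obey
  \<open>square_lincomb_le\<close>. This keeps linear combinations of representatives inside the
  space.\<close>

lemma flat_energy_lincomb:
  fixes f g :: "'a :: euclidean_space \<Rightarrow> real"
  assumes [measurable]: "f \<in> borel_measurable borel" "g \<in> borel_measurable borel"
    and fin: "flat_energy c f < \<infinity>" "flat_energy c g < \<infinity>" "c > 0"
  shows "flat_energy c (\<lambda>x. a * f x + b * g x) < \<infinity>"
proof -
  let ?h = "\<lambda>x. a * f x + b * g x"
  have fin': "near_energy f < \<infinity>" "log_energy f < \<infinity>" "near_energy g < \<infinity>" "log_energy g < \<infinity>"
    using fin by (auto simp: flat_energy_def ennreal_mult_less_top)
  define k where "k v x y = ennreal ((v x - v y)\<^sup>2 / norm (x - y) ^ DIM('a)) * indicator {z. norm z < 1} (x - y)"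
    for v :: "'a \<Rightarrow> real" and x y
  have [measurable]: "case_prod (k f) \<in> borel_measurable (lborel \<Otimes>\<^sub>M lborel)"
    "case_prod (k g) \<in> borel_measurable (lborel \<Otimes>\<^sub>M lborel)"
    unfolding k_def by measurable
  have kh: "k ?h x y \<le> ennreal (2 * a\<^sup>2) * k f x y + ennreal (2 * b\<^sup>2) * k g x y" for x y
  proof (cases "norm (x - y) < 1")
    case True
    let ?d = "norm (x - y) ^ DIM('a)"
    have "?h x - ?h y = a * (f x - f y) + b * (g x - g y)"
      by (simp add: algebra_simps)
    then have "(?h x - ?h y)\<^sup>2 / ?d \<le> (2 * a\<^sup>2 * (f x - f y)\<^sup>2 + 2 * b\<^sup>2 * (g x - g y)\<^sup>2) / ?d"
      using square_lincomb_le by (intro divide_right_mono) auto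
    also have "\<dots> = 2 * a\<^sup>2 * ((f x - f y)\<^sup>2 / ?d) + 2 * b\<^sup>2 * ((g x - g y)\<^sup>2 / ?d)"
      by (simp add: add_divide_distrib)
    finally have "ennreal ((?h x - ?h y)\<^sup>2 / ?d) \<le> ennreal (2 * a\<^sup>2 * ((f x - f y)\<^sup>2 / ?d) + 2 * b\<^sup>2 * ((g x - g y)\<^sup>2 / ?d))"
      by (rule ennreal_leI)
    also have "\<dots> = ennreal (2 * a\<^sup>2) * ennreal ((f x - f y)\<^sup>2 / ?d) + ennreal (2 * b\<^sup>2) * ennreal ((g x - g y)\<^sup>2 / ?d)"
      using ennreal_lincomb[of "2 * a\<^sup>2" "(f x - f y)\<^sup>2 / ?d" "2 * b\<^sup>2" "(g x - g y)\<^sup>2 / ?d" 1] by simp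
    finally show ?thesis using True by (simp only: k_def indicator_simps mem_Collect_eq mult_1_right)
  qed (simp add: k_def)
  have "near_energy ?h = (\<integral>\<^sup>+x. (\<integral>\<^sup>+y. k ?h x y \<partial>lborel) \<partial>lborel)"
    by (simp add: near_energy_def k_def)
  also have "\<dots> \<le> (\<integral>\<^sup>+x. (\<integral>\<^sup>+y. ennreal (2 * a\<^sup>2) * k f x y + ennreal (2 * b\<^sup>2) * k g x y \<partial>lborel) \<partial>lborel)"
    by (intro nn_integral2_mono kh)
  also have "\<dots> = ennreal (2 * a\<^sup>2) * near_energy f + ennreal (2 * b\<^sup>2) * near_energy g"
    unfolding near_energy_def k_def[symmetric] by (simp add: nn_integral2_add nn_integral2_cmult)
  also have "\<dots> < \<infinity>"
    using fin' by (simp add: ennreal_mult_less_top)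
  finally have near: "near_energy ?h < \<infinity>" .
  have "log_energy ?h \<le> (\<integral>\<^sup>+x. ennreal (2 * a\<^sup>2) * ennreal ((f x)\<^sup>2 * ln (exp 1 + (norm x)\<^sup>2)) +
      ennreal (2 * b\<^sup>2) * ennreal ((g x)\<^sup>2 * ln (exp 1 + (norm x)\<^sup>2)) \<partial>lborel)"
    unfolding log_energy_def
  proof (rule nn_integral_mono)
    fix x :: 'a
    let ?l = "ln (exp 1 + (norm x)\<^sup>2)"
    have l: "?l \<ge> 0"
      using one_le_ln_exp_1_add[of "norm x"] by linarith
    have "(?h x)\<^sup>2 * ?l \<le> (2 * a\<^sup>2 * (f x)\<^sup>2 + 2 * b\<^sup>2 * (g x)\<^sup>2) * ?l"
      using l by (intro mult_right_mono square_lincomb_le)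
    also have "\<dots> = 2 * a\<^sup>2 * ((f x)\<^sup>2 * ?l) + 2 * b\<^sup>2 * ((g x)\<^sup>2 * ?l)"
      by (simp add: algebra_simps)
    finally have "ennreal ((?h x)\<^sup>2 * ?l) \<le> ennreal (2 * a\<^sup>2 * ((f x)\<^sup>2 * ?l) + 2 * b\<^sup>2 * ((g x)\<^sup>2 * ?l))"
      by (rule ennreal_leI)
    also have "\<dots> = ennreal (2 * a\<^sup>2) * ennreal ((f x)\<^sup>2 * ?l) + ennreal (2 * b\<^sup>2) * ennreal ((g x)\<^sup>2 * ?l)"
      using l ennreal_lincomb[of "2 * a\<^sup>2" "(f x)\<^sup>2 * ?l" "2 * b\<^sup>2" "(g x)\<^sup>2 * ?l" 1] by simp
    finally show "ennreal ((?h x)\<^sup>2 * ?l) \<le> ennreal (2 * a\<^sup>2) * ennreal ((f x)\<^sup>2 * ?l) + ennreal (2 * b\<^sup>2) * ennreal ((g x)\<^sup>2 * ?l)" .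
  qed
  also have "\<dots> = ennreal (2 * a\<^sup>2) * log_energy f + ennreal (2 * b\<^sup>2) * log_energy g"
    unfolding log_energy_def by (subst nn_integral_add) (simp_all add: nn_integral_cmult)
  also have "\<dots> < \<infinity>"
    using fin' by (simp add: ennreal_mult_less_top)
  finally show ?thesis
    using near by (simp add: flat_energy_def ennreal_mult_less_top)
qed

section \<open>Smooth functions with compact support\<close>

lemma C_1_lipschitz_on_cball:
  fixes v :: "real ^ 'n \<Rightarrow> real"
  assumes "C_k 1 v"
  obtains L where "\<And>x y. x \<in> cball 0 r \<Longrightarrow> y \<in> cball 0 r \<Longrightarrow> \<bar>v x - v y\<bar> \<le> L * norm (x - y)"
proof -
  let ?g = "\<lambda>i x. frechet_derivative v (at x) (axis i 1)"
  have C1: "C_k (Suc 0) v" using assms by simp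
  then have diff: "v differentiable_on UNIV" and cont: "\<And>i. continuous_on UNIV (?g i)"
    by simp_all
  have "\<exists>B. \<forall>x\<in>cball 0 r. \<bar>?g i x\<bar> \<le> B" for i
  proof -
    have "compact (?g i ` cball 0 r)"
      by (intro compact_continuous_image continuous_on_subset[OF cont]) auto
    then have "bounded (?g i ` cball 0 r)"
      by (rule compact_imp_bounded)
    then show ?thesis
      by (auto simp: bounded_iff)
  qed
  then obtain B where B: "\<And>i x. x \<in> cball 0 r \<Longrightarrow> \<bar>?g i x\<bar> \<le> B i" by metis
  have der: "(v has_derivative frechet_derivative v (at x)) (at x)" for x
    using diff by (simp add: differentiable_on_def frechet_derivative_works)
  have "\<bar>v x - v y\<bar> \<le> (\<Sum>i\<in>UNIV. B i) * norm (x - y)" if "x \<in> cball 0 r" "y \<in> cball 0 r" for x y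
  proof -
    have "norm (v x - v y) \<le> (\<Sum>i\<in>UNIV. B i) * norm (x - y)"
    \<comment> \<open>The mean value inequality needs a convex set, hence the ball. The operator
      norm is bounded by expanding a vector in coordinates and summing the bounds of the partial
      derivatives.\<close>
    proof (rule differentiable_bound[OF convex_cball _ _ that])
      show "(v has_derivative frechet_derivative v (at z)) (at z within cball 0 r)" for z
        by (rule has_derivative_at_withinI[OF der])
      show "onorm (frechet_derivative v (at z)) \<le> (\<Sum>i\<in>UNIV. B i)" if z: "z \<in> cball 0 r" for z
      proof (rule onorm_le)
        fix h :: "real ^ 'n"
        have lin: "linear (frechet_derivative v (at z))"
          using der has_derivative_linear by blast
        have "frechet_derivative v (at z) h = frechet_derivative v (at z) (\<Sum>i\<in>UNIV. (h $ i) *\<^sub>R axis i 1)"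
          by (simp add: basis_expansion flip: scalar_mult_eq_scaleR)
        also have "\<dots> = (\<Sum>i\<in>UNIV. h $ i * ?g i z)"
          by (simp add: linear_sum[OF lin] linear_cmul[OF lin])
        finally have "norm (frechet_derivative v (at z) h) \<le> (\<Sum>i\<in>UNIV. \<bar>h $ i * ?g i z\<bar>)"
          by simp
        also have "\<dots> \<le> (\<Sum>i\<in>UNIV. norm h * B i)"
          unfolding abs_mult by (intro sum_mono mult_mono component_le_norm_cart B z) auto
        finally show "norm (frechet_derivative v (at z) h) \<le> (\<Sum>i\<in>UNIV. B i) * norm h"
          by (simp add: sum_distrib_left mult.commute)
      qed
    qed
    then show ?thesis by simp
  qed
  then show thesis by (rule that)
qed

lemma test_function_in_Dlog_space:
  assumes "v \<in> test_functions"
  shows "v \<in> (Dlog_space :: (real ^ 'n \<Rightarrow> real) set)"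
proof -
  let ?N = "CARD('n)"
  have C: "\<And>k. C_k k v" and "compact (closure {x. v x \<noteq> 0})"
    using assms by (auto simp: test_functions_def)
  from C[of 0] have cont: "continuous_on UNIV v" by simp
  then have [measurable]: "v \<in> borel_measurable borel"
    by (rule borel_measurable_continuous_onI)
  have "bounded {x. v x \<noteq> 0}"
    by (rule bounded_subset[OF compact_imp_bounded[OF \<open>compact (closure {x. v x \<noteq> 0})\<close>] closure_subset])
  then obtain r where "\<forall>x\<in>{x. v x \<noteq> 0}. norm x \<le> r"
    unfolding bounded_iff by blast
  then have r: "\<And>x. v x \<noteq> 0 \<Longrightarrow> norm x \<le> r" by blast
  \<comment> \<open>The radius r + 1 is chosen because two points at distance below 1, one of them
    with nonzero value of v, both lie in that ball.\<close>
  obtain L where L: "\<And>x y. x \<in> cball 0 (r + 1) \<Longrightarrow> y \<in> cball 0 (r + 1) \<Longrightarrow> \<bar>v x - v y\<bar> \<le> L * norm (x - y)"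
    using C_1_lipschitz_on_cball[OF C[of 1]] by blast
  \<comment> \<open>\<open>nn_integral_near_mass\<close> is applied to this indicator instead of v:
    the Lipschitz bound turns the near kernel of v into L^2 times the truncated kernel weighted by
    \<open>\<eta> y\<close>.\<close>
  define \<eta> where "\<eta> = (indicator (cball 0 (r + 1)) :: real ^ 'n \<Rightarrow> real)"
  have \<eta>[measurable]: "\<eta> \<in> borel_measurable borel"
    unfolding \<eta>_def by (intro borel_measurable_indicator borel_closed) simp
  have "sq_energy \<eta> = (\<integral>\<^sup>+x. indicator (cball 0 (r + 1)) x \<partial>(lborel :: (real ^ 'n) measure))"
    unfolding sq_energy_def \<eta>_def by (intro nn_integral_cong) (simp split: split_indicator)
  also have "\<dots> = emeasure lborel (cball (0 :: real ^ 'n) (r + 1))"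
    by (intro nn_integral_indicator) simp
  also have "\<dots> < \<infinity>"
    by (rule emeasure_lborel_cball_finite)
  finally have sq: "sq_energy \<eta> < \<infinity>" .
  define m where "m x y = ennreal ((\<eta> y)\<^sup>2) * (ennreal ((norm (x - y))\<^sup>2 / norm (x - y) ^ DIM(real ^ 'n)) *
      indicator {z. norm z < 1} (x - y))" for x y
  have m[measurable]: "case_prod m \<in> borel_measurable (lborel \<Otimes>\<^sub>M lborel)"
    unfolding m_def by measurable
  have "ennreal ((v x - v y)\<^sup>2 / norm (x - y) ^ DIM(real ^ 'n)) * indicator {z. norm z < 1} (x - y) \<le> ennreal (L\<^sup>2) * m x y" for x y
  proof (cases "norm (x - y) < 1 \<and> (v x \<noteq> 0 \<or> v y \<noteq> 0)")
    case True
    then have "x \<in> cball 0 (r + 1)" "y \<in> cball 0 (r + 1)"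
      using r[of x] r[of y] norm_triangle_sub[of x y] norm_triangle_sub[of y x] by (auto simp: norm_minus_commute)
    then have "(v x - v y)\<^sup>2 \<le> (L * norm (x - y))\<^sup>2" and "\<eta> y = 1"
      using L[of x y] power_mono[of "\<bar>v x - v y\<bar>" _ 2] by (auto simp: \<eta>_def)
    then have "(v x - v y)\<^sup>2 / norm (x - y) ^ DIM(real ^ 'n) \<le> (L * norm (x - y))\<^sup>2 / norm (x - y) ^ DIM(real ^ 'n)"
      by (intro divide_right_mono) auto
    also have "\<dots> = L\<^sup>2 * ((norm (x - y))\<^sup>2 / norm (x - y) ^ DIM(real ^ 'n))"
      by (simp add: power_mult_distrib)
    finally have "ennreal ((v x - v y)\<^sup>2 / norm (x - y) ^ DIM(real ^ 'n))
        \<le> ennreal (L\<^sup>2 * ((norm (x - y))\<^sup>2 / norm (x - y) ^ DIM(real ^ 'n)))"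
      by (rule ennreal_leI)
    also have "\<dots> = ennreal (L\<^sup>2) * ennreal ((norm (x - y))\<^sup>2 / norm (x - y) ^ DIM(real ^ 'n))"
      by (rule ennreal_mult') simp
    finally show ?thesis using True \<open>\<eta> y = 1\<close> by (simp add: m_def)
  qed auto
  then have "near_energy v \<le> (\<integral>\<^sup>+x. (\<integral>\<^sup>+y. ennreal (L\<^sup>2) * m x y \<partial>lborel) \<partial>lborel)"
    unfolding near_energy_def by (rule nn_integral2_mono)
  also have "\<dots> = ennreal (L\<^sup>2) * (\<integral>\<^sup>+x. (\<integral>\<^sup>+y. m x y \<partial>lborel) \<partial>lborel)"
    by (rule nn_integral2_cmult) measurable
  also have "(\<integral>\<^sup>+x. (\<integral>\<^sup>+y. m x y \<partial>lborel) \<partial>lborel)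
      = ennreal (DIM(real ^ 'n) * unit_ball_vol DIM(real ^ 'n) / 2) * sq_energy \<eta>"
    unfolding m_def by (rule nn_integral_near_mass[OF \<eta>])
  also have "ennreal (L\<^sup>2) * \<dots> < \<infinity>"
    using sq by (simp add: ennreal_mult_less_top)
  finally have near: "near_energy v < \<infinity>" .
  have "compact (v ` cball 0 (r + 1))"
    by (intro compact_continuous_image continuous_on_subset[OF cont]) auto
  then have "\<exists>M. \<forall>x\<in>cball 0 (r + 1). \<bar>v x\<bar> \<le> M"
    using compact_imp_bounded[of "v ` cball 0 (r + 1)"] by (auto simp: bounded_iff)
  then obtain M where M: "\<And>x. x \<in> cball 0 (r + 1) \<Longrightarrow> \<bar>v x\<bar> \<le> M"
    by metis
  have "log_energy v \<le> (\<integral>\<^sup>+x. ennreal (M\<^sup>2 * ln (exp 1 + r\<^sup>2)) * ennreal ((\<eta> x)\<^sup>2) \<partial>lborel)"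
    unfolding log_energy_def
  proof (rule nn_integral_mono)
    fix x :: "real ^ 'n"
    show "ennreal ((v x)\<^sup>2 * ln (exp 1 + (norm x)\<^sup>2)) \<le> ennreal (M\<^sup>2 * ln (exp 1 + r\<^sup>2)) * ennreal ((\<eta> x)\<^sup>2)"
    proof (cases "v x = 0")
      case False
      then have xr: "norm x \<le> r" by (rule r)
      then have "(v x)\<^sup>2 \<le> M\<^sup>2"
        using M[of x] power_mono[of "\<bar>v x\<bar>" M 2] by simp
      moreover have "ln (exp 1 + (norm x)\<^sup>2) \<le> ln (exp 1 + r\<^sup>2)"
        using xr by (intro ln_mono add_left_mono power_mono add_pos_nonneg) auto
      moreover have "0 \<le> ln (exp 1 + (norm x)\<^sup>2)"
        using one_le_ln_exp_1_add[of "norm x"] by linarith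
      ultimately have "(v x)\<^sup>2 * ln (exp 1 + (norm x)\<^sup>2) \<le> M\<^sup>2 * ln (exp 1 + r\<^sup>2)"
        by (intro mult_mono) auto
      then show ?thesis using xr by (simp add: \<eta>_def ennreal_leI)
    qed simp
  qed
  also have "\<dots> = ennreal (M\<^sup>2 * ln (exp 1 + r\<^sup>2)) * sq_energy \<eta>"
    unfolding sq_energy_def by (rule nn_integral_cmult) measurable
  also have "\<dots> < \<infinity>"
    using sq by (simp add: ennreal_mult_less_top)
  finally show ?thesis
    using near by (simp add: Dlog_space_eq flat_energy_def ennreal_mult_less_top)
qed

theorem theorem3p10:
  fixes \<kappa> :: real
  assumes "\<kappa> > Max {2 * (Digamma (real CARD('n) / 2) - Digamma (real CARD('n) / 4)),
                     A_const CARD('n), 1}"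
  shows "(\<exists>C>1. \<forall>v \<in> (test_functions :: (real ^ 'n \<Rightarrow> real) set).
            v \<in> D_space \<kappa> \<and> v \<in> Dlog_space \<and>
            inverse C * Dlog_norm v \<le> D_norm \<kappa> v \<and> D_norm \<kappa> v \<le> C * Dlog_norm v)
       \<and> (\<exists>T. ae_isomorphism
            lborel (D_space \<kappa> :: (real ^ 'n \<Rightarrow> real) set) (D_norm \<kappa>)
            lborel (Dlog_space :: (real ^ 'n \<Rightarrow> real) set) Dlog_norm T)"
proof (intro conjI)
  let ?V = "Dlog_space :: (real ^ 'n \<Rightarrow> real) set"
  have \<kappa>: "\<kappa> > 0"
    using assms by simp
  note eq = D_space_eq_Dlog_space(1)[OF \<kappa>, where 'n = 'n]
  obtain C1 where C1: "\<And>v. v \<in> ?V \<Longrightarrow> D_norm \<kappa> v \<le> C1 * Dlog_norm v"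
    using D_space_eq_Dlog_space(2)[OF \<kappa>] by blast
  obtain C2 where C2: "\<And>v. v \<in> ?V \<Longrightarrow> Dlog_norm v \<le> C2 * D_norm \<kappa> v"
    using D_space_eq_Dlog_space(3)[OF \<kappa>] by blast
  have nonneg: "0 \<le> Dlog_norm v" "0 \<le> D_norm \<kappa> v" if "v \<in> ?V" for v
    using that D_norm_eq[of v \<kappa>] by (simp_all add: eq Dlog_norm_def)
  \<comment> \<open>The entry 2 forces C > 1.\<close>
  define C where "C = max 2 (max C1 C2)"
  have "C > 1" "C1 \<le> C" "C2 \<le> C"
    by (auto simp: C_def)
  have "inverse C * Dlog_norm v \<le> D_norm \<kappa> v \<and> D_norm \<kappa> v \<le> C * Dlog_norm v" if v: "v \<in> ?V" for v
  proof
    have "Dlog_norm v \<le> C * D_norm \<kappa> v"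
      using C2[OF v] mult_right_mono[OF \<open>C2 \<le> C\<close> nonneg(2)[OF v]] by linarith
    then show "inverse C * Dlog_norm v \<le> D_norm \<kappa> v"
      using \<open>C > 1\<close> by (simp add: field_simps)
    show "D_norm \<kappa> v \<le> C * Dlog_norm v"
      using C1[OF v] mult_right_mono[OF \<open>C1 \<le> C\<close> nonneg(1)[OF v]] by linarith
  qed
  then show "\<exists>C>1. \<forall>v \<in> (test_functions :: (real ^ 'n \<Rightarrow> real) set).
      v \<in> D_space \<kappa> \<and> v \<in> Dlog_space \<and>
      inverse C * Dlog_norm v \<le> D_norm \<kappa> v \<and> D_norm \<kappa> v \<le> C * Dlog_norm v"
    using \<open>C > 1\<close> test_function_in_Dlog_space unfolding eq by blast
  \<comment> \<open>Boundedness is stated for any representative f' of the image class, whereas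
    \<open>C1\<close> and \<open>C2\<close> compare the norms of f itself.\<close>
  have norm_cong: "Dlog_norm f' = Dlog_norm f" if "f' \<in> ae_class lborel ?V f" for f f'
    using that flat_energy_cong_AE[of f' f] by (simp add: ae_class_def Dlog_norm_def Dlog_energy_eq)
  have "ae_isomorphism lborel ?V (D_norm \<kappa>) lborel ?V Dlog_norm (\<lambda>X. X)"
    unfolding ae_isomorphism_def
  proof (intro conjI ballI allI)
    show "bij_betw (\<lambda>X. X) (ae_class lborel ?V ` ?V) (ae_class lborel ?V ` ?V)"
      by (simp add: bij_betw_def)
  next
    fix f g f' g' :: "real ^ 'n \<Rightarrow> real" and a b
    assume f': "f' \<in> ae_class lborel ?V f" and g': "g' \<in> ae_class lborel ?V g"
    \<comment> \<open>Membership in a class includes membership in the space, so closure under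
      linear combinations is needed for the representatives f' and g'.\<close>
    have "(\<lambda>x. a * f' x + b * g' x) \<in> ?V"
      using f' g' c_const_pos[where 'n = 'n]
      by (auto simp: ae_class_def Dlog_space_eq intro!: flat_energy_lincomb[simplified])
    moreover have "AE x in lborel. a * f' x + b * g' x = a * f x + b * g x"
    proof -
      have "AE x in lborel. f' x = f x" "AE x in lborel. g' x = g x"
        using f' g' by (auto simp: ae_class_def)
      then show ?thesis by eventually_elim simp
    qed
    ultimately show "(\<lambda>x. a * f' x + b * g' x) \<in> ae_class lborel ?V (\<lambda>x. a * f x + b * g x)"
      by (simp add: ae_class_def)
  next
    show "\<exists>C. \<forall>f\<in>?V. \<forall>f'\<in>ae_class lborel ?V f. Dlog_norm f' \<le> C * D_norm \<kappa> f"
      using C2 norm_cong by metis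
    show "\<exists>C. \<forall>f\<in>?V. \<forall>f'\<in>ae_class lborel ?V f. D_norm \<kappa> f \<le> C * Dlog_norm f'"
      using C1 norm_cong by metis
  qed
  then show "\<exists>T. ae_isomorphism lborel (D_space \<kappa> :: (real ^ 'n \<Rightarrow> real) set) (D_norm \<kappa>) lborel ?V Dlog_norm T"
    unfolding eq by blast
qed

end
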